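(* Let $n$ be a positive integer with $n\equiv 3\pmod 4$, and let $M=(n-1)/2$ or $M=n-1$. Then $$\sum_{k=0}^{M}(-1)^k[4k+1]\frac{(q;q^2)_k^4(q^2;q^4)_k}{(q^2;q^2)_k^4(q^4;q^4)_k}q^k\equiv[n]^2q^{(1+n)/2}\frac{(q^3;q^4)_{(n-1)/2}}{(q^5;q^4)_{(n-1)/2}}\pmod{[n]\Phi_n(q)^3}.$$
   Context: For a nonnegative integer $k$, $(x;q)_0=1$ and $(x;q)_k=(1-x)(1-xq)\cdots(1-xq^{k-1})$ for $k\ge 1$; the same notation is used with base $q$ replaced by $q^2$ or $q^4$. $[m]=(1-q^m)/(1-q)$, and $\Phi_n(q)$ is the $n$-th cyclotomic polynomial in $q$. For rational functions $A,B\in\mathbb{Q}(q)$ and a polynomial $P\in\mathbb{Q}[q]$, $A\equiv B\pmod P$ means that $A-B$, written in lowest terms, has numerator divisible by $P$. *)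

theory Defs
  imports
    Complex_Main
    "HOL-Computational_Algebra.Computational_Algebra"
    "HOL-Computational_Algebra.Field_as_Ring"
    "HOL-Number_Theory.Totient"
begin

definition qpoch :: "'a \<Rightarrow> 'a \<Rightarrow> nat \<Rightarrow> 'a :: comm_ring_1" where
  "qpoch x b k = (\<Prod>j<k. 1 - x * b ^ j)"

definition qvar :: "rat poly fract" where
  "qvar = to_fract [:0, 1:]"

text \<open>The division is exact in \<open>\<rat>[q]\<close>, see \<open>to_fract_qint\<close>. The values are polynomials because
  they also occur in a modulus.\<close>

definition qint :: "nat \<Rightarrow> rat poly" where
  "qint m = (1 - [:0, 1:] ^ m) div (1 - [:0, 1:])"

definition cyclotomic_complex :: "nat \<Rightarrow> complex poly" where
  "cyclotomic_complex n = (\<Prod>k\<in>totatives n. [:- cis (2 * pi * real k / real n), 1:])"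

text \<open>For \<open>n > 0\<close> such a rational polynomial exists and is unique, see
  \<open>map_poly_of_rat_cyclotomic\<close>.\<close>

definition cyclotomic :: "nat \<Rightarrow> rat poly" where
  "cyclotomic n = (THE p. map_poly of_rat p = cyclotomic_complex n)"

text \<open>\<^const>\<open>quot_of_fract\<close> returns numerator and denominator in lowest terms.\<close>

definition fract_cong :: "rat poly fract \<Rightarrow> rat poly fract \<Rightarrow> rat poly \<Rightarrow> bool" where
  "fract_cong A B P \<longleftrightarrow> P dvd fst (quot_of_fract (A - B))"


lemma to_fract_power: "to_fract (p ^ m) = to_fract p ^ m"
  by (induction m) simp_all

lemma to_fract_qint: "to_fract (qint m) = (1 - qvar ^ m) / (1 - qvar)"
proof -
  have "(1 - [:0, 1:] :: rat poly) dvd 1 - [:0, 1:] ^ m"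
    by (metis one_diff_power_eq dvd_triv_left)
  then have "qint m * (1 - [:0, 1:]) = 1 - [:0, 1:] ^ m"
    unfolding qint_def by (rule dvd_div_mult_self)
  then have "to_fract (qint m * (1 - [:0, 1:])) = to_fract (1 - [:0, 1:] ^ m)"
    by (rule arg_cong)
  then have *: "to_fract (qint m) * (1 - qvar) = 1 - qvar ^ m"
    by (simp add: qvar_def to_fract_power del: to_fract_eq_iff)
  have "to_fract ([:1, -1:] :: rat poly) \<noteq> 0"
    by (subst to_fract_eq_0_iff) simp
  moreover have "1 - qvar = to_fract ([:1, -1:] :: rat poly)"
    unfolding qvar_def to_fract_1 [symmetric] to_fract_diff [symmetric]
    by (simp add: one_pCons)
  ultimately have "1 - qvar \<noteq> 0"
    by simp
  with * show ?thesis
    by (simp add: field_simps)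
qed

lemma map_poly_of_rat_eq_iff:
  "map_poly of_rat p = (map_poly of_rat q :: complex poly) \<longleftrightarrow> p = q"
  by (simp add: poly_eq_iff coeff_map_poly)

lemma map_poly_of_rat_mult:
  "map_poly of_rat (p * q) = (map_poly of_rat p * map_poly of_rat q :: complex poly)"
  by (rule poly_eqI) (simp add: coeff_map_poly coeff_mult of_rat_sum of_rat_mult)

lemma map_poly_of_rat_add:
  "map_poly of_rat (p + q) = (map_poly of_rat p + map_poly of_rat q :: complex poly)"
  by (rule poly_eqI) (simp add: coeff_map_poly of_rat_add)

lemma map_poly_of_rat_prod:
  "map_poly of_rat (\<Prod>i\<in>A. f i) = (\<Prod>i\<in>A. map_poly of_rat (f i) :: complex poly)"
  by (induction A rule: infinite_finite_induct) (simp_all add: map_poly_of_rat_mult)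

lemma monom_minus_1_eq_prod:
  assumes "n > 0"
  shows "monom 1 n - 1 = (\<Prod>k\<in>{0<..n}. [:- cis (2 * pi * real k / real n), 1:])"
    (is "?L = ?R")
proof (rule ccontr)
  assume neq: "?L \<noteq> ?R"
  let ?f = "\<lambda>k. cis (2 * pi * real k / real n)"
  have degR: "degree ?R = n"
    by (subst degree_prod_eq_sum_degree) auto
  have degL: "degree ?L \<le> n"
    by (intro degree_diff_le degree_monom_le) simp
  have lcR: "lead_coeff ?R = 1"
    by (simp add: lead_coeff_prod)
  have "coeff (?L - ?R) n = 0"
    using lcR assms unfolding degR by simp
  moreover have "degree (?L - ?R) \<le> n"
    using degL degR by (metis degree_diff_le order_refl)
  ultimately have deg: "degree (?L - ?R) < n"
    using neq by (metis (no_types, lifting) eq_zero_or_degree_less right_minus_eq)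
  have "{z. z ^ n = 1} \<subseteq> {z. poly (?L - ?R) z = 0}"
  proof safe
    fix z :: complex
    assume z: "z ^ n = 1"
    then obtain k where k: "k < n" "z = ?f k"
      using bij_betw_roots_unity[OF assms] by (auto simp: bij_betw_def)
    define l where "l = (if k = 0 then n else k)"
    have "l \<in> {0<..n}" "z = ?f l"
      using k assms by (auto simp: l_def)
    then have "poly ?R z = 0"
      by (auto simp: poly_prod)
    then show "poly (?L - ?R) z = 0"
      using z by (simp add: poly_monom)
  qed
  moreover have "finite {z. poly (?L - ?R) z = 0}"
    using neq by (intro poly_roots_finite) auto
  ultimately have "card {z::complex. z ^ n = 1} \<le> card {z. poly (?L - ?R) z = 0}"
    by (intro card_mono)
  also have "\<dots> \<le> degree (?L - ?R)"
    using neq by (intro card_poly_roots_bound) auto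
  finally show False
    using deg card_roots_unity_eq[OF assms] by simp
qed

lemma prod_cyclotomic_complex:
  assumes "n > 0"
  shows "(\<Prod>d | d dvd n. cyclotomic_complex d) = monom 1 n - 1"
proof -
  let ?g = "\<lambda>n k. [:- cis (2 * pi * real k / real n), 1:]"
  have "monom 1 n - 1 = prod (?g n) {0<..n}"
    by (rule monom_minus_1_eq_prod[OF assms])
  also have "\<dots> = (\<Prod>d | d dvd n. prod (?g n) {k \<in> {0<..n}. gcd k n = d})"
    using assms by (intro prod.group[symmetric]) auto
  also have "\<dots> = (\<Prod>d | d dvd n. cyclotomic_complex (n div d))"
  proof (rule prod.cong)
    fix d assume "d \<in> {d. d dvd n}"
    then have d: "d dvd n" "d > 0"
      using assms by (auto intro: dvd_pos_nat)
    have "cyclotomic_complex (n div d) = (\<Prod>k\<in>totatives (n div d). ?g n (k * d))"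
      unfolding cyclotomic_complex_def using d assms
      by (intro prod.cong) (auto simp: real_of_nat_div mult.assoc)
    also have "\<dots> = prod (?g n) {k \<in> {0<..n}. gcd k n = d}"
      by (rule prod.reindex_bij_betw[OF bij_betw_totatives_gcd_eq]) (use d assms in auto)
    finally show "prod (?g n) {k \<in> {0<..n}. gcd k n = d} = cyclotomic_complex (n div d)" ..
  qed simp
  also have "\<dots> = (\<Prod>d | d dvd n. cyclotomic_complex d)"
    using assms
    by (intro prod.reindex_bij_witness[of _ "\<lambda>d. n div d" "\<lambda>d. n div d"])
       (auto intro: div_dvd_div simp: dvd_div_eq_mult)
  finally show ?thesis ..
qed

lemma ex_rat_cyclotomic:
  assumes "n > 0"
  shows "\<exists>p. map_poly of_rat p = cyclotomic_complex n"
  using assms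
proof (induction n rule: less_induct)
  case (less n)
  define D where "D = {d. d dvd n \<and> d \<noteq> n}"
  have D: "finite D" "{d. d dvd n} = insert n D" "n \<notin> D"
    using less.prems by (auto simp: D_def)
  have "\<forall>d\<in>D. \<exists>p. map_poly of_rat p = cyclotomic_complex d"
    using less by (auto simp: D_def intro!: less.IH intro: dvd_pos_nat dest: dvd_imp_le)
  then obtain P where P: "\<And>d. d \<in> D \<Longrightarrow> map_poly of_rat (P d) = cyclotomic_complex d"
    by metis
  let ?h = "map_poly of_rat :: rat poly \<Rightarrow> complex poly"
  define Q where "Q = (\<Prod>d\<in>D. P d)"
  define X :: "rat poly" where "X = monom 1 n - 1"
  have Q: "?h Q = (\<Prod>d\<in>D. cyclotomic_complex d)"
    by (simp add: Q_def map_poly_of_rat_prod P)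
  have nz: "?h Q \<noteq> 0"
    unfolding Q by (auto simp: D cyclotomic_complex_def)
  have "?h X = monom 1 n - 1"
    by (rule poly_eqI) (simp add: X_def coeff_map_poly of_rat_diff)
  also have "\<dots> = ?h Q * cyclotomic_complex n"
    using prod_cyclotomic_complex[OF less.prems] D unfolding Q by (simp add: mult.commute)
  finally have X: "?h X = ?h Q * cyclotomic_complex n" .
  have "?h X = ?h Q * ?h (X div Q) + ?h (X mod Q)"
    by (simp flip: map_poly_of_rat_mult map_poly_of_rat_add)
  then have eq: "?h Q * (cyclotomic_complex n - ?h (X div Q)) = ?h (X mod Q)"
    using X by (simp add: algebra_simps)
  have "cyclotomic_complex n - ?h (X div Q) = 0"
  proof (rule ccontr)
    assume *: "cyclotomic_complex n - ?h (X div Q) \<noteq> 0"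
    have "Q \<noteq> 0"
      using nz by auto
    moreover have "X mod Q \<noteq> 0"
      using eq nz * by auto
    ultimately have "degree (X mod Q) < degree Q"
      using degree_mod_less by blast
    moreover have "degree Q \<le> degree (?h Q * (cyclotomic_complex n - ?h (X div Q)))"
      using nz * by (subst degree_mult_eq) (auto simp: degree_map_poly)
    ultimately show False
      by (simp add: eq degree_map_poly)
  qed
  then show ?case
    by (intro exI[of _ "X div Q"]) simp
qed

lemma map_poly_of_rat_cyclotomic:
  assumes "n > 0"
  shows "map_poly of_rat (cyclotomic n) = cyclotomic_complex n"
proof -
  obtain p where p: "map_poly of_rat p = cyclotomic_complex n"
    using ex_rat_cyclotomic[OF assms] by blast
  show ?thesis
    unfolding cyclotomic_def
    by (rule theI[of _ p]) (use p map_poly_of_rat_eq_iff in metis)+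
qed

end

theory Submission
  imports Defs
begin

text \<open>
  Replace two pairs of the parameters of the very-well-poised sum by \<open>(x q, q / x)\<close> and
  \<open>(y q, q / y)\<close>. Every term is then a product of an even function of \<open>x\<close>, in the multiplicative
  sense \<open>x \<leftrightarrow> 1 / x\<close>, and the same function of \<open>y\<close>. At \<open>x = q\<^sup>n\<close> the sum terminates, and a
  telescoping relation between the sums at \<open>x q\<^sup>2\<close> and \<open>x / q\<^sup>2\<close> gives it as a product, which for
  \<open>n \<equiv> 3 (mod 4)\<close> vanishes at \<open>y = 1\<close> and is the right-hand side, up to the factor \<open>- q\<^sup>n\<close>, at \<open>y = q\<^sup>n\<close>.
  The mixed difference \<open>F(1, 1) - 2 F(q\<^sup>n, 1) + F(q\<^sup>n, q\<^sup>n)\<close> is divisible by \<open>\<Phi>\<^sub>n\<^sup>4\<close> termwise, which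
  settles that modulus.

  For a prime factor \<open>\<pi>\<close> of \<open>[n]\<close> modulo which \<open>q\<close> has order \<open>d\<close>, both sides are sums that modulo
  \<open>\<pi>\<close> fall into blocks of length \<open>d\<close>, each a multiple of the first one, and the first one vanishes
  because the terminating sum at \<open>x = q\<^sup>d\<close>, \<open>y = 1\<close> is a multiple of \<open>1 - q\<^sup>d\<close>.
\<close>

section \<open>A contiguous relation for the very-well-poised sum\<close>

text \<open>In Pochhammer notation this is \<open>(x p; p^2)_k / (x p^2; p^2)_k\<close>. As a single
  product of quotients it can be shifted and reduced factor by factor.\<close>

definition poch_ratio :: "'a \<Rightarrow> 'a \<Rightarrow> nat \<Rightarrow> 'a :: field" where
  "poch_ratio p x k = (\<Prod>j<k. (1 - x * p ^ (2 * j + 1)) / (1 - x * p ^ (2 * j + 2)))"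

text \<open>The summand is \<open>wp_term q 1 1\<close>. Here \<open>poch_ratio (q ^ 2) 1\<close> stands for
  \<open>(q\<^sup>2; q\<^sup>4)\<^sub>k / (q\<^sup>4; q\<^sup>4)\<^sub>k\<close>.\<close>

definition wp_term :: "'a \<Rightarrow> 'a \<Rightarrow> 'a \<Rightarrow> nat \<Rightarrow> 'a :: field" where
  "wp_term q x y k = (1 - q ^ (4 * k + 1)) / (1 - q) * (- q) ^ k * poch_ratio (q ^ 2) 1 k
     * (poch_ratio q x k * poch_ratio q (1 / x) k) * (poch_ratio q y k * poch_ratio q (1 / y) k)"

lemma poch_ratio_0 [simp]: "poch_ratio p x 0 = 1"
  by (simp add: poch_ratio_def)

lemma poch_ratio_Suc:
  "poch_ratio p x (Suc k) = poch_ratio p x k * ((1 - x * p ^ (2 * k + 1)) / (1 - x * p ^ (2 * k + 2)))"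
  by (simp add: poch_ratio_def)

text \<open>Both sides are the product of \<open>k + 2\<close> consecutive factors starting with the
  first one for \<open>x / p ^ 2\<close>: the left side splits off the first two, the right side the
  last two.\<close>

lemma poch_ratio_shift:
  fixes p x :: "'a :: field"
  assumes "p \<noteq> 0"
  shows "poch_ratio p (x * p ^ 2) k * ((1 - x / p) / (1 - x) * ((1 - x * p) / (1 - x * p ^ 2)))
    = poch_ratio p (x / p ^ 2) k * ((1 - x * p ^ (2 * k) / p) / (1 - x * p ^ (2 * k))
        * ((1 - x * p * p ^ (2 * k)) / (1 - x * p ^ 2 * p ^ (2 * k))))"
proof -
  define b where "b = (\<lambda>j. (1 - x / p ^ 2 * p ^ (2 * j + 1)) / (1 - x / p ^ 2 * p ^ (2 * j + 2)))"
  have b: "b j = (1 - x * p ^ (2 * j) / p) / (1 - x * p ^ (2 * j))" for j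
    using assms by (simp add: b_def power_add field_simps power2_eq_square)
  have bS: "b (Suc j) = (1 - x * p * p ^ (2 * j)) / (1 - x * p ^ 2 * p ^ (2 * j))" for j
    using assms by (simp add: b power_add field_simps power2_eq_square)
  have bSS: "b (Suc (Suc j)) = (1 - x * p ^ 2 * p ^ (2 * j + 1)) / (1 - x * p ^ 2 * p ^ (2 * j + 2))" for j
    using assms by (simp add: bS power_add field_simps power2_eq_square)
  have "(\<Prod>j<Suc (Suc k). b j) = b 0 * b (Suc 0) * (\<Prod>j<k. b (Suc (Suc j)))"
    by (simp only: prod.lessThan_Suc_shift mult.assoc)
  moreover have "poch_ratio p (x * p ^ 2) k = (\<Prod>j<k. b (Suc (Suc j)))"
    by (simp only: bSS poch_ratio_def)
  moreover have "poch_ratio p (x / p ^ 2) k = (\<Prod>j<k. b j)"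
    by (simp only: b_def poch_ratio_def)
  moreover have "b 0 * b (Suc 0) = (1 - x / p) / (1 - x) * ((1 - x * p) / (1 - x * p ^ 2))"
    unfolding b[of 0] bS[of 0] by simp
  ultimately show ?thesis
    unfolding bS[of k, symmetric] b[of k, symmetric] by (simp add: mult_ac)
qed

text \<open>The certificate of the telescoping, with \<open>z = q ^ (2 * k)\<close>. The inverses are kept as variables
  to make it a polynomial identity modulo the hypotheses.\<close>

lemma wp_certificate:
  fixes q x y z xi yi qi :: "'a::field"
  assumes "x * xi = 1" "y * yi = 1" "q * qi = 1"
  shows "(1-q)*(1-x^2)*(- q*(1-q^2*z^2)*(1-y*q*z)*(1-q*z*yi)*(1-x*z*qi)*(1-z*xi*qi)
     - (1-z^2)*(1-y*z)*(1-z*yi)*((1-x*q^2*z)*(1-q^2*z*xi))) =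
   (1-q*z^2)*((q-y*x)*(q-x*yi)*((1-z*xi*qi)*(1-q*z*xi)*(1-x*z)*(1-x*q^2*z))
     -(q*x-y)*(q*x-yi)*((1-x*z*qi)*(1-x*q*z)*(1-z*xi)*(1-q^2*z*xi)))"
  using assms by algebra

text \<open>The factors shared by the terms with parameters \<open>x q\<^sup>2\<close> and \<open>x / q\<^sup>2\<close>. Taking both lower
  parameters avoids division by the factors that vanish in the terminating case.\<close>

definition wp_common :: "'a \<Rightarrow> 'a \<Rightarrow> 'a \<Rightarrow> nat \<Rightarrow> 'a :: field" where
  "wp_common q x y k = (- q) ^ k * poch_ratio (q ^ 2) 1 k * (poch_ratio q (x / q ^ 2) k
     * poch_ratio q (1 / x / q ^ 2) k) * (poch_ratio q y k * poch_ratio q (1 / y) k)"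

text \<open>Induction on \<open>K\<close>. The closed form vanishes at \<open>K = 0\<close> because
  \<open>z 0 = 1\<close>. In the step, factors of the closed form cancel denominators of the ratio
  of consecutive \<open>wp_common\<close> values, and what is left is \<open>wp_certificate\<close>
  divided by nonzero factors.\<close>

lemma wp_telescope:
  fixes q x y :: "'a :: field"
  assumes nz: "q \<noteq> 0" "x \<noteq> 0" "y \<noteq> 0"
    and d1: "\<And>k. 1 - q ^ (4 * k + 4) \<noteq> 0"
    and d2: "\<And>k. 1 - x * q ^ (2 * k) \<noteq> 0" "\<And>k. 1 - 1 / x * q ^ (2 * k) \<noteq> 0"
    and d3: "\<And>k. 1 - y * q ^ (2 * k + 2) \<noteq> 0" "\<And>k. 1 - 1 / y * q ^ (2 * k + 2) \<noteq> 0"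
  defines "z \<equiv> \<lambda>k. q ^ (2 * k)"
  shows "(\<Sum>k<K. wp_common q x y k * (1 - q * z k ^ 2)
      * ((q-y*x)*(q-x*(1/y))*((1-z k*(1/x)*(1/q))*(1-q*z k*(1/x))*(1-x*z k)*(1-x*q^2*z k))
     -(q*x-y)*(q*x-(1/y))*((1-x*z k*(1/q))*(1-x*q*z k)*(1-z k*(1/x))*(1-q^2*z k*(1/x))))
     / ((1-x*z k)*(1-z k*(1/x))*((1-x*q^2*z k)*(1-q^2*z k*(1/x)))))
   = (1-q)*(1-x^2) * wp_common q x y K * (1-z K^2)*(1-y*z K)*(1-z K*(1/y)) / ((1-x*z K)*(1-z K*(1/x)))"
proof (induction K)
  case 0
  then show ?case by (simp add: z_def)
next
  case (Suc K)
  define w where "w = z K"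
  have zS: "z (Suc K) = q ^ 2 * w" by (simp add: z_def w_def power2_eq_square)
  have w4: "q ^ (4 * K + i) = w ^ 2 * q ^ i" for i
    by (simp add: w_def z_def power_add flip: power_mult)
  have w2: "q ^ (2 * K + i) = w * q ^ i" for i
    by (simp add: w_def z_def power_add flip: power_mult)
  have e1: "1 - q ^ 4 * w ^ 2 \<noteq> 0" using d1[of K] unfolding w4 by (simp add: mult.commute)
  have e2: "1 - x * w \<noteq> 0" "1 - w * (1/x) \<noteq> 0" "1 - x * q^2 * w \<noteq> 0" "1 - q^2 * w * (1/x) \<noteq> 0"
    using d2[of K] d2[of "Suc K"] by (simp_all add: w_def z_def mult_ac power2_eq_square)
  have e3: "1 - y * q^2 * w \<noteq> 0" "1 - q^2 * w * (1/y) \<noteq> 0"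
    using d3[of K] unfolding w2 by (simp_all add: mult_ac)
  define D1 D2 where "D1 = (1 - x*w) * (1 - w*(1/x))" and "D2 = (1 - x*q^2*w) * (1 - q^2*w*(1/x))"
  have D: "D1 \<noteq> 0" "D2 \<noteq> 0" using e2 by (simp_all add: D1_def D2_def)
  define W where "W = wp_common q x y K"
  define a where "a = - q*(1-q^2*w^2)*(1-y*q*w)*(1-q*w*(1/y))*(1-x*w*(1/q))*(1-w*(1/x)*(1/q))"
  define b where "b = (1-w^2)*(1-y*w)*(1-w*(1/y))"
  define b' where "b' = (1-(q^2*w)^2)*(1-y*(q^2*w))*(1-(q^2*w)*(1/y))"
  define N where "N = (1 - q * w ^ 2) * ((q-y*x)*(q-x*(1/y))*((1-w*(1/x)*(1/q))*(1-q*w*(1/x))*(1-x*w)*(1-x*q^2*w))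
     -(q*x-y)*(q*x-(1/y))*((1-x*w*(1/q))*(1-x*q*w)*(1-w*(1/x))*(1-q^2*w*(1/x))))"
  \<comment> \<open>Over the common denominator \<open>D1 * D2\<close>, \<open>a\<close> belongs to
    the new boundary term, \<open>b * D2\<close> to the old one and \<open>N\<close> to the
    summand.\<close>
  have star: "(1-q)*(1-x^2)*(a - b * D2) = N"
    unfolding a_def b_def N_def D2_def
    using wp_certificate[of x "1/x" y "1/y" q "1/q" w] nz by simp
  have q4: "q ^ 4 = (q ^ 2) ^ 2" by simp
  have WS: "wp_common q x y (Suc K) = W * (- q * ((1-q^2*w^2) / (1 - q^4*w^2))
     * ((1-x*w*(1/q)) / (1 - x*w) * ((1-w*(1/x)*(1/q)) / (1 - w*(1/x))))
     * ((1-y*q*w) / (1-y*q^2*w) * ((1-q*w*(1/y)) / (1-q^2*w*(1/y)))))"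
  proof -
    have f1: "(1 - 1 * (q^2) ^ (2 * K + 1)) / (1 - 1 * (q^2) ^ (2 * K + 2)) = (1-q^2*w^2) / (1 - q^4*w^2)"
      by (simp add: w_def z_def power_add flip: power_mult)
    have f2: "(1 - x / q^2 * q ^ (2 * K + 1)) / (1 - x / q^2 * q ^ (2 * K + 2)) = (1-x*w*(1/q)) / (1 - x*w)"
      unfolding w2 using nz by (simp add: power2_eq_square)
    have f3: "(1 - 1 / x / q^2 * q ^ (2 * K + 1)) / (1 - 1 / x / q^2 * q ^ (2 * K + 2)) = (1-w*(1/x)*(1/q)) / (1 - w*(1/x))"
      unfolding w2 using nz by (simp add: power2_eq_square)
    have f4: "(1 - y * q ^ (2 * K + 1)) / (1 - y * q ^ (2 * K + 2)) = (1-y*q*w) / (1-y*q^2*w)"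
      unfolding w2 by (simp add: mult_ac)
    have f5: "(1 - 1/y * q ^ (2 * K + 1)) / (1 - 1/y * q ^ (2 * K + 2)) = (1-q*w*(1/y)) / (1-q^2*w*(1/y))"
      unfolding w2 by (simp add: mult_ac)
    show ?thesis
      unfolding wp_common_def poch_ratio_Suc f1 f2 f3 f4 f5 W_def power_Suc by (simp only: mult_ac)
  qed
  have b': "b' = (1 - q^4*w^2) * ((1-y*q^2*w) * (1-q^2*w*(1/y)))"
    by (simp add: b'_def power_mult_distrib mult_ac flip: power_mult)
  have cancel: "W * (- q * (n1 / m1) * (n2 / m2 * (n3 / m3)) * (n4 / m4 * (n5 / m5))) * (m1 * (m4 * m5))
     = W * (- q * n1 * n4 * n5 * n2 * n3) / (m2 * m3)"
     if "m1 \<noteq> 0" "m4 \<noteq> 0" "m5 \<noteq> 0" for n1 n2 n3 n4 n5 m1 m2 m3 m4 m5 :: 'a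
    using that by (simp add: field_simps)
  have WSb: "wp_common q x y (Suc K) * b' = W * a / D1"
    unfolding WS b' a_def D1_def by (rule cancel[OF e1 e3])
  have "(1-q)*(1-x^2) * W * b / D1 + W * N / (D1 * D2) = (1-q)*(1-x^2) * (W * a / D1) / D2"
    unfolding star[symmetric] using D by (simp add: field_simps)
  also have "\<dots> = (1-q)*(1-x^2) * (wp_common q x y (Suc K) * b') / D2"
    by (simp only: WSb)
  finally show ?case
    unfolding sum.lessThan_Suc Suc zS
    by (simp only: w_def[symmetric] W_def b_def b'_def D1_def D2_def N_def mult_ac)
qed

text \<open>By \<open>poch_ratio_shift\<close> at \<open>x\<close> and at \<open>1 / x\<close>, both
  shifted terms are multiples of \<open>wp_common\<close>. Their combination is the summand of
  \<open>wp_telescope\<close>, up to the factor \<open>1 - q\<close>, and \<open>W0\<close> kills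
  the boundary term.\<close>

lemma wp_contiguous:
  fixes q x y :: "'a :: field"
  assumes nz: "q \<noteq> 0" "x \<noteq> 0" "y \<noteq> 0"
    and d1: "\<And>k. 1 - q ^ (4 * k + 4) \<noteq> 0"
    and d2: "\<And>k. 1 - x * q ^ (2 * k) \<noteq> 0" "\<And>k. 1 - 1 / x * q ^ (2 * k) \<noteq> 0"
    and d3: "\<And>k. 1 - y * q ^ (2 * k + 2) \<noteq> 0" "\<And>k. 1 - 1 / y * q ^ (2 * k + 2) \<noteq> 0"
    and W0: "wp_common q x y K = 0"
  shows "(q - y * x) * (q - x / y) * ((1 - 1 / x / q) / (1 - 1 / x) * ((1 - 1 / x * q) / (1 - 1 / x * q ^ 2)))
      * (\<Sum>k<K. wp_term q (x / q ^ 2) y k)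
    = (q * x - y) * (q * x - 1 / y) * ((1 - x / q) / (1 - x) * ((1 - x * q) / (1 - x * q ^ 2)))
      * (\<Sum>k<K. wp_term q (x * q ^ 2) y k)" (is "?A * ?cY * _ = ?B * ?cX * _")
proof -
  define z where "z = (\<lambda>k. q ^ (2 * k))"
  have v: "1 - q ^ (4 * k + 1) = 1 - q * z k ^ 2" for k
    by (simp add: z_def flip: power_mult)
  have inv: "1 / (x * q ^ 2) = 1 / x / q ^ 2" "1 / (x / q ^ 2) = 1 / x * q ^ 2"
    by simp_all
  have t1: "?cX * wp_term q (x * q ^ 2) y k = wp_common q x y k * ((1 - q * z k ^ 2) / (1 - q))
     * ((1 - x * z k / q) / (1 - x * z k) * ((1 - x * q * z k) / (1 - x * q ^ 2 * z k)))" for k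
  proof -
    have "?cX * wp_term q (x * q ^ 2) y k = (1 - q * z k ^ 2) / (1 - q) * (- q) ^ k * poch_ratio (q ^ 2) 1 k
     * ((poch_ratio q (x * q ^ 2) k * ?cX) * poch_ratio q (1 / x / q ^ 2) k) * (poch_ratio q y k * poch_ratio q (1 / y) k)"
      unfolding wp_term_def inv v by (simp only: mult_ac)
    then show ?thesis
      unfolding poch_ratio_shift[OF nz(1)] wp_common_def z_def by (simp only: mult_ac)
  qed
  have t2: "?cY * wp_term q (x / q ^ 2) y k = wp_common q x y k * ((1 - q * z k ^ 2) / (1 - q))
     * ((1 - 1 / x * z k / q) / (1 - 1 / x * z k) * ((1 - 1 / x * q * z k) / (1 - 1 / x * q ^ 2 * z k)))" for k
  proof -
    have "?cY * wp_term q (x / q ^ 2) y k = (1 - q * z k ^ 2) / (1 - q) * (- q) ^ k * poch_ratio (q ^ 2) 1 k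
     * (poch_ratio q (x / q ^ 2) k * (poch_ratio q (1 / x * q ^ 2) k * ?cY)) * (poch_ratio q y k * poch_ratio q (1 / y) k)"
      unfolding wp_term_def inv v by (simp only: mult_ac)
    then show ?thesis
      unfolding poch_ratio_shift[OF nz(1)] wp_common_def z_def by (simp only: mult_ac)
  qed
  have alg: "w * g * ((A*(u1*u2*v1*v2) - B*(s1*s2*r1*r2)) / (v1*r1*(v2*r2))) / h
     = A * (w * (g / h) * ((u1/r1) * (u2/r2))) - B * (w * (g / h) * ((s1/v1) * (s2/v2)))"
    if "v1 \<noteq> 0" "v2 \<noteq> 0" "r1 \<noteq> 0" "r2 \<noteq> 0"
    for w g A B u1 u2 v1 v2 s1 s2 r1 r2 h :: 'a
  proof -
    have "(A*(u1*u2*v1*v2) - B*(s1*s2*r1*r2)) / (v1*r1*(v2*r2)) = A * ((u1/r1) * (u2/r2)) - B * ((s1/v1) * (s2/v2))"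
      using that by (simp add: field_simps)
    then show ?thesis by (simp add: right_diff_distrib diff_divide_distrib mult_ac)
  qed
  have nz1: "1 - x * z k \<noteq> 0" "1 - x * q ^ 2 * z k \<noteq> 0" "1 - z k * (1 / x) \<noteq> 0" "1 - q ^ 2 * z k * (1 / x) \<noteq> 0" for k
    using d2[of k] d2[of "Suc k"] by (simp_all add: z_def power2_eq_square mult_ac)
  have "0 = (\<Sum>k<K. wp_common q x y k * (1 - q * z k ^ 2)
      * (((q-y*x)*(q-x*(1/y))*((1-z k*(1/x)*(1/q))*(1-q*z k*(1/x))*(1-x*z k)*(1-x*q^2*z k))
     -(q*x-y)*(q*x-(1/y))*((1-x*z k*(1/q))*(1-x*q*z k)*(1-z k*(1/x))*(1-q^2*z k*(1/x))))
     / ((1-x*z k)*(1-z k*(1/x))*((1-x*q^2*z k)*(1-q^2*z k*(1/x)))))) / (1 - q)"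
    using wp_telescope[OF nz d1 d2 d3, of K] unfolding z_def W0 by simp
  also have "\<dots> = (\<Sum>k<K. ?A * (?cY * wp_term q (x / q ^ 2) y k) - ?B * (?cX * wp_term q (x * q ^ 2) y k))"
    unfolding sum_divide_distrib
  proof (intro sum.cong refl)
    fix k
    show "wp_common q x y k * (1 - q * z k ^ 2)
      * (((q-y*x)*(q-x*(1/y))*((1-z k*(1/x)*(1/q))*(1-q*z k*(1/x))*(1-x*z k)*(1-x*q^2*z k))
     -(q*x-y)*(q*x-(1/y))*((1-x*z k*(1/q))*(1-x*q*z k)*(1-z k*(1/x))*(1-q^2*z k*(1/x))))
     / ((1-x*z k)*(1-z k*(1/x))*((1-x*q^2*z k)*(1-q^2*z k*(1/x))))) / (1 - q)
     = ?A * (?cY * wp_term q (x / q ^ 2) y k) - ?B * (?cX * wp_term q (x * q ^ 2) y k)"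
      unfolding alg[OF nz1(1,2,3,4)] t1 t2 by (simp add: mult_ac)
  qed
  finally show ?thesis
    by (simp add: sum_subtractf sum_distrib_left mult.assoc)
qed

section \<open>Terminating sums and their evaluation as products\<close>

lemma wp_term_0: "q \<noteq> 1 \<Longrightarrow> wp_term q x y 0 = 1"
  by (simp add: wp_term_def)

lemma poch_ratio_eq_0:
  assumes "x * p ^ (2 * j + 1) = 1" "j < k"
  shows "poch_ratio p x k = 0"
  unfolding poch_ratio_def using assms by (intro prod_zero) auto

text \<open>The numerator factor with \<open>2 * j + 1 = n\<close> is zero and is present as soon as
  \<open>n < 2 * k\<close>. This makes the sums at \<open>x = q ^ n\<close> terminate.\<close>

lemma poch_ratio_inverse_power_eq_0:
  fixes q :: "'a :: field"
  assumes "q \<noteq> 0" "odd n" "n < 2 * k"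
  shows "poch_ratio q (1 / q ^ n) k = 0"
proof -
  obtain j where "n = 2 * j + 1" using assms(2) by (rule oddE)
  then show ?thesis using assms by (intro poch_ratio_eq_0[of _ _ j]) auto
qed

lemma wp_term_eq_0:
  fixes q :: "'a :: field"
  assumes "q \<noteq> 0" "odd n" "n < 2 * k"
  shows "wp_term q (q ^ n) y k = 0"
  using poch_ratio_inverse_power_eq_0[OF assms] by (simp add: wp_term_def)

locale generic_base =
  fixes q :: "'a :: field"
  assumes q_nz: "q \<noteq> 0" and q_power_neq_1: "\<And>i. i > 0 \<Longrightarrow> q ^ i \<noteq> 1"
begin

lemma q_power_cancel: "q ^ i = q ^ j \<longleftrightarrow> i = j"
proof
  have "i = j" if "i \<le> j" "q ^ i = q ^ j" for i j
  proof (rule ccontr)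
    assume "i \<noteq> j"
    have "q ^ j = q ^ i * q ^ (j - i)" by (metis le_add_diff_inverse power_add that(1))
    then have "q ^ (j - i) = 1" using that q_nz by simp
    then show False using q_power_neq_1[of "j - i"] that \<open>i \<noteq> j\<close> by simp
  qed
  then show "q ^ i = q ^ j \<Longrightarrow> i = j" by (metis nat_le_linear)
qed simp

text \<open>Take \<open>x = q ^ (n + 2)\<close> in \<open>wp_contiguous\<close>, so that the shifted
  parameters are \<open>q ^ n\<close> and \<open>q ^ (n + 4)\<close>. For odd \<open>n\<close> no
  even power of \<open>q\<close> equals \<open>x\<close>, so no denominator vanishes, and
  \<open>n + 4 < 2 * K\<close> makes the boundary term zero.\<close>

lemma wp_sum_step:
  assumes y: "y \<noteq> 0" "\<And>k. 1 - y * q ^ (2 * k + 2) \<noteq> 0" "\<And>k. 1 - 1 / y * q ^ (2 * k + 2) \<noteq> 0"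
    and n: "odd n" "n + 4 < 2 * K"
  shows "(\<Sum>k<K. wp_term q (q ^ (n + 4)) y k) * (1 - q ^ n) * ((1 - q ^ (n + 3) * y) * (1 - q ^ (n + 3) / y))
    = (\<Sum>k<K. wp_term q (q ^ n) y k) * (1 - q ^ (n + 4)) * ((1 - q ^ (n + 1) * y) * (1 - q ^ (n + 1) / y))"
proof -
  define x where "x = q ^ (n + 2)"
  have xnz: "x \<noteq> 0" using q_nz by (simp add: x_def)
  have d1: "1 - q ^ (4 * k + 4) \<noteq> 0" for k using q_power_neq_1[of "4 * k + 4"] by simp
  have d2: "1 - x * q ^ (2 * k) \<noteq> 0" for k
    using q_power_neq_1[of "n + 2 + 2 * k"] by (simp add: x_def power_add mult_ac)
  have d2': "1 - 1 / x * q ^ (2 * k) \<noteq> 0" for k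
  proof
    assume "1 - 1 / x * q ^ (2 * k) = 0"
    then have "q ^ (n + 2) = q ^ (2 * k)" using xnz by (simp add: field_simps x_def)
    then show False using n(1) unfolding q_power_cancel by presburger
  qed
  have "1 / x / q ^ 2 = 1 / q ^ (n + 4)"
    by (simp add: x_def power_add power2_eq_square eval_nat_numeral)
  then have W0: "wp_common q x y K = 0"
    using poch_ratio_inverse_power_eq_0[OF q_nz, of "n + 4" K] n by (simp add: wp_common_def)
  note main = wp_contiguous[OF q_nz xnz y(1) d1 d2 d2' y(2,3) W0]
  have x1: "x / q ^ 2 = q ^ n" "x * q ^ 2 = q ^ (n + 4)" "q * x = q ^ (n + 3)" "x = q * q ^ (n + 1)"
    using q_nz by (simp_all add: x_def power_add power2_eq_square eval_nat_numeral)
  \<comment> \<open>The common part of both parameter quotients, which cancels; only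
    \<open>q ^ 2 * (1 - q ^ n)\<close> and \<open>1 - q ^ (n + 4)\<close> remain as
    denominators.\<close>
  define c where "c = (1 - x * q) * (1 - x / q) / (1 - x)"
  have ne: "1 - x \<noteq> 0" "1 - 1 / x \<noteq> 0" "1 - 1 / x * q ^ 2 \<noteq> 0" "1 - x * q ^ 2 \<noteq> 0"
    using d2[of 0] d2[of 1] d2'[of 0] d2'[of 1] by simp_all
  have c: "c \<noteq> 0"
    using ne q_power_neq_1[of "n + 3"] q_power_neq_1[of "n + 1"] q_nz
    by (simp add: c_def x_def eval_nat_numeral mult_ac)
  have qn: "1 - q ^ n \<noteq> 0" "1 - q ^ (n + 4) \<noteq> 0"
    using q_power_neq_1[of n] q_power_neq_1[of "n+4"] n(1) by (auto simp: odd_pos)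
  have cY: "(1 - 1 / x / q) / (1 - 1 / x) * ((1 - 1 / x * q) / (1 - 1 / x * q ^ 2)) = c / (q ^ 2 * (1 - q ^ n))"
  proof -
    have "(1 - 1 / x / q) / (1 - 1 / x) * ((1 - 1 / x * q) / (1 - 1 / x * q ^ 2))
      = (x * q - 1) * (x - q) / (q * (x - 1) * (x - q ^ 2))"
    proof -
      have *: "1 - 1 / x / q = (x * q - 1) / (x * q)" "1 - 1 / x = (x - 1) / x"
        "1 - 1 / x * q = (x - q) / x" "1 - 1 / x * q ^ 2 = (x - q ^ 2) / x"
        using xnz q_nz by (simp_all add: diff_divide_distrib)
      show ?thesis
        using xnz q_nz unfolding * by simp
    qed
    also have "\<dots> = c / (q ^ 2 * (1 - x / q ^ 2))"
    proof -
      have *: "1 - x / q ^ 2 = - (x - q ^ 2) / q ^ 2" "1 - x / q = - (x - q) / q"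
        "1 - x * q = - (x * q - 1)" "1 - x = - (x - 1)"
        using q_nz by (simp_all add: diff_divide_distrib)
      show ?thesis
        using q_nz unfolding c_def * by (simp del: minus_diff_eq)
    qed
    finally show ?thesis by (simp only: x1(1))
  qed
  have cX: "(1 - x / q) / (1 - x) * ((1 - x * q) / (1 - x * q ^ 2)) = c / (1 - q ^ (n + 4))"
    unfolding c_def x1(2) by (simp only: times_divide_times_eq divide_divide_eq_left mult_ac)
  have A: "(q - y * x) * (q - x / y) = q ^ 2 * ((1 - q ^ (n + 1) * y) * (1 - q ^ (n + 1) / y))"
    unfolding x1(4) by (simp add: algebra_simps power2_eq_square)
  have B: "(q * x - y) * (q * x - 1 / y) = (1 - q ^ (n + 3) * y) * (1 - q ^ (n + 3) / y)"
    unfolding x1(3) using y(1) by (simp add: algebra_simps)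
  have "c * ((1 - q ^ (n + 1) * y) * (1 - q ^ (n + 1) / y)) / (1 - q ^ n) * (\<Sum>k<K. wp_term q (q ^ n) y k)
     = c * ((1 - q ^ (n + 3) * y) * (1 - q ^ (n + 3) / y)) / (1 - q ^ (n + 4)) * (\<Sum>k<K. wp_term q (q ^ (n + 4)) y k)"
    using main[unfolded A B cX cY, unfolded x1(1,2)] q_nz by (simp add: mult_ac)
  moreover have "S' * u * b = S * t * a" if "c * a / u * S = c * b / t * S'" "u \<noteq> 0" "t \<noteq> 0"
    for a b u t S S'
    using that c by (simp add: field_simps)
  ultimately show ?thesis
    using qn by blast
qed

lemma wp_sum_restrict:
  assumes "odd n" "n < 2 * K" "K \<le> L"
  shows "(\<Sum>k<L. wp_term q (q ^ n) y k) = (\<Sum>k<K. wp_term q (q ^ n) y k)"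
  by (rule sum.mono_neutral_right) (use assms in \<open>auto intro!: wp_term_eq_0 q_nz\<close>)

text \<open>Iterate \<open>wp_sum_step\<close> from \<open>n = 3\<close>: the step from
  \<open>4 * m + 3\<close> to \<open>4 * m + 7\<close> supplies the product factor at
  \<open>i = m + 1\<close>, and the factors \<open>1 - q ^ n\<close> telescope. The factor at
  \<open>i = 0\<close> has numerator \<open>(1 - y) * (1 - 1 / y)\<close>, so the sum vanishes at
  \<open>y = 1\<close>.\<close>

lemma wp_sum_3_mod_4:
  assumes y: "y \<noteq> 0" "\<And>k. 1 - y * q ^ (2 * k + 2) \<noteq> 0" "\<And>k. 1 - 1 / y * q ^ (2 * k + 2) \<noteq> 0"
    and "4 * m + 3 < 2 * K"
  shows "(\<Sum>k<K. wp_term q (q ^ (4 * m + 3)) y k) = - q * ((1 - q ^ (4 * m + 3)) / (1 - q))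
    * (\<Prod>i<Suc m. (1 - q ^ (4 * i) * y) * (1 - q ^ (4 * i) / y)
        / ((1 - q ^ (4 * i + 2) * y) * (1 - q ^ (4 * i + 2) / y)))"
  using assms(4)
proof (induction m)
  case 0
  have nz: "1 - q \<noteq> 0" "1 + q \<noteq> 0" "1 - q ^ 2 \<noteq> 0" "1 - q ^ 4 \<noteq> 0" "1 - q ^ 5 \<noteq> 0"
    using q_power_neq_1[of 1] q_power_neq_1[of 2] q_power_neq_1[of 4] q_power_neq_1[of 5]
    by (auto simp: add_eq_0_iff)
  have d: "1 - q ^ 2 * y \<noteq> 0" "y - q ^ 2 \<noteq> 0"
    using y(2)[of 0] y(3)[of 0] y(1) by (simp_all add: field_simps power2_eq_square)
  \<comment> \<open>At \<open>x = q ^ 3\<close> only the terms \<open>k = 0\<close> and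
    \<open>k = 1\<close> survive.\<close>
  have "(\<Sum>k<K. wp_term q (q ^ 3) y k) = (\<Sum>k<2. wp_term q (q ^ 3) y k)"
    by (rule wp_sum_restrict) (use 0 in auto)
  also have "\<dots> = 1 + wp_term q (q ^ 3) y 1"
    using nz by (simp add: wp_term_0 numeral_2_eq_2)
  also have "wp_term q (q ^ 3) y 1 = - ((1 + q) ^ 2) * ((1 - y * q) * (y - q)) / ((1 - q ^ 2 * y) * (y - q ^ 2))"
  proof -
    have p: "poch_ratio (q ^ 2) 1 1 = 1 / (1 + q ^ 2)"
    proof -
      have "(1 - q ^ 4) = (1 - q ^ 2) * (1 + q ^ 2)" by (simp add: algebra_simps flip: power_add)
      then show ?thesis using nz by (simp add: poch_ratio_def flip: power_mult)
    qed
    have p1: "poch_ratio q (q ^ 3) 1 = (1 - q ^ 4) / (1 - q ^ 5)"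
      by (simp add: poch_ratio_def eval_nat_numeral mult_ac)
    have p2: "poch_ratio q (1 / q ^ 3) 1 = (1 + q) / q"
      using nz q_nz by (simp add: poch_ratio_def divide_simps) (simp add: algebra_simps eval_nat_numeral)
    have p3: "poch_ratio q y 1 * poch_ratio q (1 / y) 1 = (1 - y * q) * (y - q) / ((1 - q ^ 2 * y) * (y - q ^ 2))"
      using y(1) d by (simp add: poch_ratio_def divide_simps) (simp add: algebra_simps eval_nat_numeral)
    have q4: "1 - q ^ 4 = (1 - q) * (1 + q) * (1 + q ^ 2)"
      by (simp add: algebra_simps eval_nat_numeral)
    have "1 + q ^ 2 \<noteq> 0" using q4 nz by auto
    then have "(1 - q ^ 5) / (1 - q) * (- q) * (1 / (1 + q ^ 2)) * ((1 - q ^ 4) / (1 - q ^ 5) * ((1 + q) / q)) = - ((1 + q) ^ 2)"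
      unfolding q4 using nz q_nz by (simp add: power2_eq_square)
    then show ?thesis
      unfolding wp_term_def p p1 p2 p3 by simp
  qed
  also have "1 + (- ((1 + q) ^ 2) * ((1 - y * q) * (y - q)) / ((1 - q ^ 2 * y) * (y - q ^ 2)))
     = - q * (1 + q + q ^ 2) * ((1 - y) * (y - 1)) / ((1 - q ^ 2 * y) * (y - q ^ 2))"
    using d by (simp add: divide_simps) (simp add: algebra_simps eval_nat_numeral)
  also have "1 + q + q ^ 2 = (1 - q ^ 3) / (1 - q)"
    using nz by (simp add: divide_simps) (simp add: algebra_simps eval_nat_numeral)
  also have "- q * ((1 - q ^ 3) / (1 - q)) * ((1 - y) * (y - 1)) / ((1 - q ^ 2 * y) * (y - q ^ 2))
    = - q * ((1 - q ^ 3) / (1 - q)) * ((1 - y) * (1 - 1 / y) / ((1 - q ^ 2 * y) * (1 - q ^ 2 / y)))"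
  proof -
    have "(1 - y) * (y - 1) / ((1 - q ^ 2 * y) * (y - q ^ 2)) = (1 - y) * (1 - 1 / y) / ((1 - q ^ 2 * y) * (1 - q ^ 2 / y))"
      using d y(1) by (simp add: divide_simps)
    then show ?thesis by (metis times_divide_eq_right)
  qed
  finally show ?case by (simp add: power2_eq_square)
next
  case (Suc m)
  define n where "n = 4 * m + 3"
  have n: "odd n" "n + 4 < 2 * K" using Suc.prems by (simp_all add: n_def)
  have i: "n + 1 = 4 * Suc m" "n + 3 = 4 * Suc m + 2" "n + 4 = 4 * Suc m + 3"
    by (simp_all add: n_def)
  have nz: "1 - q ^ n \<noteq> 0" using q_power_neq_1[of n] by (simp add: n_def)
  have y': "1 - q ^ (n + 3) * y \<noteq> 0" "1 - q ^ (n + 3) / y \<noteq> 0"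
  proof -
    have *: "n + 3 = 2 * (2 * m + 2) + 2" by (simp add: n_def)
    show "1 - q ^ (n + 3) * y \<noteq> 0" "1 - q ^ (n + 3) / y \<noteq> 0"
      unfolding * using y(2,3)[of "2 * m + 2"] by (simp_all only: mult.commute times_divide_eq_left times_divide_eq_right mult_1 mult_1_right not_False_eq_True)
  qed
  have IH: "(\<Sum>k<K. wp_term q (q ^ n) y k) = - q * ((1 - q ^ n) / (1 - q))
    * (\<Prod>i<Suc m. (1 - q ^ (4 * i) * y) * (1 - q ^ (4 * i) / y)
        / ((1 - q ^ (4 * i + 2) * y) * (1 - q ^ (4 * i + 2) / y)))" (is "_ = _ * ?P")
    unfolding n_def by (rule Suc.IH) (use Suc.prems in simp)
  have alg: "s = a * (t / h) * (P * (b / c))"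
    if "s * u * c = a * (u / h) * P * t * b" "u \<noteq> 0" "c \<noteq> 0" for s a u h P t b c :: 'a
  proof -
    have "s = a * (u / h) * P * t * b / (u * c)"
      using that by (metis mult.assoc mult_eq_0_iff nonzero_mult_div_cancel_right)
    also have "\<dots> = a * (t / h) * (P * (b / c))" using that by simp
    finally show ?thesis .
  qed
  show ?case
    unfolding prod.lessThan_Suc[of _ "Suc m"]
    by (rule alg[OF wp_sum_step[OF y n(1,2), unfolded IH] nz, unfolded i]) (use y' in \<open>simp add: i\<close>)
qed

end

section \<open>Local filtrations\<close>

text \<open>\<open>I 0\<close> plays the role of a local ring inside the field and
  \<open>I i\<close> that of the i-th power of its maximal ideal \<open>I 1\<close>. The last
  assumption says that the residue field has characteristic zero. The instance used is
  \<open>prime_filtration\<close>.\<close>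

locale local_filtration =
  fixes I :: "nat \<Rightarrow> 'a :: field set"
  assumes zero_mem: "0 \<in> I i" and one_mem: "1 \<in> I 0" and one_notin: "1 \<notin> I 1"
    and minus_mem: "x \<in> I i \<Longrightarrow> - x \<in> I i"
    and add_mem: "x \<in> I i \<Longrightarrow> y \<in> I i \<Longrightarrow> x + y \<in> I i"
    and mult_mem: "x \<in> I i \<Longrightarrow> y \<in> I j \<Longrightarrow> x * y \<in> I (i + j)"
    and Suc_subset: "I (Suc i) \<subseteq> I i"
    and inverse_mem: "x \<in> I 0 \<Longrightarrow> x \<notin> I 1 \<Longrightarrow> inverse x \<in> I 0"
    and of_nat_notin: "v > 0 \<Longrightarrow> of_nat v \<notin> I 1"
begin

lemma diff_mem: "x \<in> I i \<Longrightarrow> y \<in> I i \<Longrightarrow> x - y \<in> I i"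
  using add_mem[of x i "- y"] minus_mem by simp

lemma mem_antimono: "x \<in> I j \<Longrightarrow> i \<le> j \<Longrightarrow> x \<in> I i"
  using lift_Suc_antimono_le[of I i j] Suc_subset by blast

lemma mem_0: "x \<in> I j \<Longrightarrow> x \<in> I 0"
  by (rule mem_antimono) auto

lemma mult_mem_0: "x \<in> I 0 \<Longrightarrow> y \<in> I j \<Longrightarrow> x * y \<in> I j"
  using mult_mem[of x 0 y j] by simp

lemma mult_mem_0': "x \<in> I j \<Longrightarrow> y \<in> I 0 \<Longrightarrow> x * y \<in> I j"
  using mult_mem[of x j y 0] by simp

lemma sum_mem: "(\<And>k. k \<in> A \<Longrightarrow> f k \<in> I i) \<Longrightarrow> sum f A \<in> I i"
  by (induction A rule: infinite_finite_induct) (auto intro: zero_mem add_mem)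

lemma prod_mem: "(\<And>k. k \<in> A \<Longrightarrow> f k \<in> I 0) \<Longrightarrow> prod f A \<in> I 0"
  by (induction A rule: infinite_finite_induct) (auto intro: one_mem mult_mem_0)

lemma power_mem: "x \<in> I 0 \<Longrightarrow> x ^ k \<in> I 0"
  by (induction k) (auto intro: one_mem mult_mem_0)

lemma of_nat_mem: "of_nat v \<in> I 0"
  by (induction v) (auto intro: one_mem zero_mem add_mem)

definition local_unit :: "'a \<Rightarrow> bool" where
  "local_unit x \<longleftrightarrow> x \<in> I 0 \<and> x \<notin> I 1"

lemma local_unit_nz: "local_unit x \<Longrightarrow> x \<noteq> 0"
  using zero_mem by (auto simp: local_unit_def)

lemma divide_mem: "x \<in> I i \<Longrightarrow> local_unit y \<Longrightarrow> x / y \<in> I i"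
  unfolding divide_inverse local_unit_def using mult_mem_0' inverse_mem by blast

lemma local_unit_1: "local_unit 1"
  using one_mem one_notin by (simp add: local_unit_def)

lemma local_unit_mult: "local_unit x \<Longrightarrow> local_unit y \<Longrightarrow> local_unit (x * y)"
proof -
  assume u: "local_unit x" "local_unit y"
  have "x * y / x \<in> I 1" if "x * y \<in> I 1" using divide_mem[OF that u(1)] .
  then show ?thesis
    using u local_unit_nz[OF u(1)] by (auto simp: local_unit_def intro: mult_mem_0)
qed

lemma local_unit_power: "local_unit x \<Longrightarrow> local_unit (x ^ k)"
  by (induction k) (auto intro: local_unit_1 local_unit_mult)

lemma local_unit_prod: "(\<And>k. k \<in> A \<Longrightarrow> local_unit (f k)) \<Longrightarrow> local_unit (prod f A)"
  by (induction A rule: infinite_finite_induct) (auto intro: local_unit_1 local_unit_mult)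

lemma local_unit_cong:
  assumes "local_unit x" "x - y \<in> I 1"
  shows "local_unit y"
proof -
  have *: "y = x - (x - y)" "x = y + (x - y)" by simp_all
  have "y \<in> I 0"
    by (subst *(1), rule diff_mem) (use assms mem_0 in \<open>auto simp: local_unit_def\<close>)
  moreover have "y \<notin> I 1"
    using add_mem[of y 1 "x - y"] assms *(2) by (auto simp: local_unit_def)
  ultimately show ?thesis by (simp add: local_unit_def)
qed

lemma local_unit_minus: "local_unit x \<Longrightarrow> local_unit (- x)"
  using minus_mem[of x 0] minus_mem[of "- x" 1] by (auto simp: local_unit_def)

lemma mult_diff_mem:
  assumes "x \<in> I 0" "y' \<in> I 0" "x - y \<in> I i" "x' - y' \<in> I i"
  shows "x * x' - y * y' \<in> I i"
proof -
  have "x * x' - y * y' = x * (x' - y') + (x - y) * y'" by (simp add: algebra_simps)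
  moreover have "x * (x' - y') \<in> I i" "(x - y) * y' \<in> I i"
    using assms mult_mem_0 mult_mem_0' by blast+
  ultimately show ?thesis by (simp add: add_mem)
qed

lemma prod_diff_mem:
  fixes k :: nat
  assumes "\<And>j. j < k \<Longrightarrow> f j \<in> I 0" "\<And>j. j < k \<Longrightarrow> g j \<in> I 0" "\<And>j. j < k \<Longrightarrow> f j - g j \<in> I i"
  shows "(\<Prod>j<k. f j) - (\<Prod>j<k. g j) \<in> I i"
  using assms
  by (induction k) (auto intro!: zero_mem mult_diff_mem prod_mem)

lemma divide_diff_mem:
  assumes "a' \<in> I 0" "local_unit b" "local_unit b'" "a - a' \<in> I i" "b - b' \<in> I i"
  shows "a / b - a' / b' \<in> I i"
proof -
  have "a / b - a' / b' = ((a - a') * b' - a' * (b - b')) / (b * b')"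
    using assms(2,3)[THEN local_unit_nz] by (simp add: field_simps)
  moreover have "(a - a') * b' \<in> I i" "a' * (b - b') \<in> I i"
    using assms mult_mem_0 mult_mem_0' unfolding local_unit_def by blast+
  ultimately show ?thesis
    using assms by (simp add: divide_mem local_unit_mult diff_mem)
qed

text \<open>The order of \<open>p\<close> in the residue field \<open>I 0 / I 1\<close>.\<close>

definition root_order :: "'a \<Rightarrow> nat \<Rightarrow> bool" where
  "root_order p d \<longleftrightarrow> local_unit p \<and> (\<forall>i. 1 - p ^ i \<in> I 1 \<longleftrightarrow> d dvd i)"

lemma root_order_unit: "root_order p d \<Longrightarrow> \<not> d dvd i \<Longrightarrow> local_unit (1 - p ^ i)"
  by (auto simp: root_order_def local_unit_def intro: diff_mem one_mem power_mem)

lemma near_1_mult: "1 - x \<in> I 1 \<Longrightarrow> 1 - y \<in> I 1 \<Longrightarrow> 1 - x * y \<in> I 1"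
proof -
  assume *: "1 - x \<in> I 1" "1 - y \<in> I 1"
  have "1 * 1 - x * y \<in> I 1"
    by (rule mult_diff_mem) (use * local_unit_cong[OF local_unit_1] in \<open>auto simp: local_unit_def one_mem\<close>)
  then show ?thesis by simp
qed

lemma near_1_unit: "1 - x \<in> I 1 \<Longrightarrow> local_unit x"
  using local_unit_cong[OF local_unit_1] .

lemma near_1_inverse:
  assumes "1 - x \<in> I 1" shows "1 - 1 / x \<in> I 1"
proof -
  have u: "local_unit x" by (rule near_1_unit[OF assms])
  have "1 - 1 / x = - ((1 - x) / x)" using local_unit_nz[OF u] by (simp add: field_simps)
  then show ?thesis using divide_mem[OF assms u] minus_mem by simp
qed

lemma near_1_unit_shift:
  assumes "root_order p d" "\<not> d dvd i" "1 - x \<in> I 1"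
  shows "local_unit (1 - x * p ^ i)"
proof (rule local_unit_cong[OF root_order_unit[OF assms(1,2)]])
  have "(1 - p ^ i) - (1 - x * p ^ i) = - ((1 - x) * p ^ i)" by (simp add: algebra_simps)
  also have "\<dots> \<in> I 1"
    using assms by (auto intro!: minus_mem mult_mem_0' power_mem simp: root_order_def local_unit_def)
  finally show "(1 - p ^ i) - (1 - x * p ^ i) \<in> I 1" .
qed

text \<open>For \<open>0 < j + 1 < d\<close> and odd \<open>d\<close> the exponent
  \<open>2 * j + 2\<close> is no multiple of \<open>d\<close>, so every denominator is a
  unit.\<close>

lemma poch_ratio_mem:
  assumes p: "root_order p d" "odd d" and x: "1 - x \<in> I 1" and k: "k < d"
  shows "poch_ratio p x k \<in> I 0"
  unfolding poch_ratio_def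
proof (rule prod_mem)
  fix j assume j: "j \<in> {..<k}"
  have "x \<in> I 0" "p \<in> I 0" using near_1_unit[OF x] p by (auto simp: local_unit_def root_order_def)
  moreover have "\<not> d dvd 2 * (j + 1)"
    using coprime_dvd_mult_right_iff[of d 2 "j+1"] p(2) j k by (auto dest: dvd_imp_le)
  ultimately show "(1 - x * p ^ (2 * j + 1)) / (1 - x * p ^ (2 * j + 2)) \<in> I 0"
    using near_1_unit_shift[OF p(1) _ x, of "2 * j + 2"]
    by (intro divide_mem) (auto intro!: diff_mem one_mem mult_mem_0 power_mem)
qed

lemma poch_ratio_near_1:
  assumes p: "root_order p d" "odd d" and x: "1 - x \<in> I 1" and k: "k < d"
  shows "poch_ratio p x k - poch_ratio p 1 k \<in> I 1"
  unfolding poch_ratio_def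
proof (rule prod_diff_mem)
  fix j assume j: "j < k"
  have xp: "x \<in> I 0" "p \<in> I 0" using near_1_unit[OF x] p by (auto simp: local_unit_def root_order_def)
  have n1: "1 - 1 \<in> I 1" by (simp add: zero_mem)
  have nd: "\<not> d dvd 2 * j + 2"
    using coprime_dvd_mult_right_iff[of d 2 "j+1"] p(2) j k by (auto dest: dvd_imp_le)
  note u = near_1_unit_shift[OF p(1) nd x] near_1_unit_shift[OF p(1) nd n1]
  show "(1 - x * p ^ (2 * j + 1)) / (1 - x * p ^ (2 * j + 2)) \<in> I 0"
       "(1 - 1 * p ^ (2 * j + 1)) / (1 - 1 * p ^ (2 * j + 2)) \<in> I 0"
    using xp u by (auto intro!: divide_mem diff_mem one_mem mult_mem_0 power_mem simp del: power_Suc mult_1)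
  have d: "(1 - x * p ^ i) - (1 - 1 * p ^ i) \<in> I 1" for i
  proof -
    have "(1 - x * p ^ i) - (1 - 1 * p ^ i) = (1 - x) * p ^ i" by (simp add: algebra_simps)
    then show ?thesis using x xp by (auto intro!: mult_mem_0' power_mem)
  qed
  show "(1 - x * p ^ (2 * j + 1)) / (1 - x * p ^ (2 * j + 2))
      - (1 - 1 * p ^ (2 * j + 1)) / (1 - 1 * p ^ (2 * j + 2)) \<in> I 1"
    by (rule divide_diff_mem[OF _ u d d]) (use xp in \<open>auto intro!: diff_mem one_mem power_mem simp del: power_Suc\<close>)
qed

text \<open>Over a full period exactly one numerator exponent, \<open>d\<close>, and one denominator
  exponent, \<open>2 * d\<close>, are multiples of \<open>d\<close>. The quotient of these two
  factors is integral by \<open>r\<close>, and the other denominators are units.\<close>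

lemma poch_ratio_block:
  assumes p: "root_order p d" "odd d" and x: "1 - x \<in> I 1"
    and r: "(1 - x * p ^ d) / (1 - x * p ^ (2 * d)) \<in> I 0"
  shows "poch_ratio p x d \<in> I 0"
proof -
  obtain h where h: "d = 2 * h + 1" using p(2) by (rule oddE)
  have xp: "x \<in> I 0" "p \<in> I 0" using near_1_unit[OF x] p by (auto simp: local_unit_def root_order_def)
  have "poch_ratio p x d = (\<Prod>j<d. 1 - x * p ^ (2 * j + 1)) / (\<Prod>j<d. 1 - x * p ^ (2 * j + 2))"
    by (simp add: poch_ratio_def prod_dividef)
  also have "(\<Prod>j<d. 1 - x * p ^ (2 * j + 1)) = (1 - x * p ^ d) * (\<Prod>j\<in>{..<d}-{h}. 1 - x * p ^ (2 * j + 1))"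
    by (subst prod.remove[of _ h]) (auto simp: h)
  also have "(\<Prod>j<d. 1 - x * p ^ (2 * j + 2)) = (1 - x * p ^ (2 * d)) * (\<Prod>j<2*h. 1 - x * p ^ (2 * j + 2))"
    by (simp add: h mult.commute)
  also have "(1 - x * p ^ d) * (\<Prod>j\<in>{..<d}-{h}. 1 - x * p ^ (2 * j + 1)) / \<dots>
     = (1 - x * p ^ d) / (1 - x * p ^ (2 * d))
       * ((\<Prod>j\<in>{..<d}-{h}. 1 - x * p ^ (2 * j + 1)) / (\<Prod>j<2*h. 1 - x * p ^ (2 * j + 2)))"
    by simp
  also have "\<dots> \<in> I 0"
  proof (intro mult_mem_0 r divide_mem prod_mem local_unit_prod)
    fix j assume "j \<in> {..<2*h}"
    then have "\<not> d dvd 2 * j + 2"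
      using coprime_dvd_mult_right_iff[of d 2 "j+1"] p(2) h by (auto dest: dvd_imp_le)
    then show "local_unit (1 - x * p ^ (2 * j + 2))" by (rule near_1_unit_shift[OF p(1) _ x])
  qed (use xp in \<open>auto intro!: diff_mem one_mem power_mem mult_mem_0 simp del: power_Suc\<close>)
  finally show ?thesis .
qed

end

section \<open>Block structure of the sums modulo a prime at which \<open>q\<close> has odd order
  \<open>d\<close>\<close>

lemma poch_ratio_add: "poch_ratio p x (a + b) = poch_ratio p x a * poch_ratio p (x * p ^ (2 * a)) b"
  by (induction b) (simp_all add: poch_ratio_Suc power_add mult_ac)

lemma sum_lessThan_add: "(\<Sum>k<a + b. f k) = (\<Sum>k<a. f k) + (\<Sum>k<b. f (a + k))"
  for f :: "nat \<Rightarrow> 'b :: comm_monoid_add"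
  by (induction b) (simp_all add: add.assoc)

locale filtered_base = generic_base q + local_filtration I for q :: "'a :: field" and I :: "nat \<Rightarrow> 'a set" +
  fixes d :: nat
  assumes order: "root_order q d" and odd_d: "odd d" and d_gt_1: "d > 1"
begin

lemma q_unit: "local_unit q" and q_mem: "q \<in> I 0"
  using order by (auto simp: root_order_def local_unit_def)

lemma near_1_power: "1 - q ^ i \<in> I 1 \<longleftrightarrow> d dvd i"
  using order by (simp add: root_order_def)

lemma unit_1_minus_power: "\<not> d dvd i \<Longrightarrow> local_unit (1 - q ^ i)"
  using root_order_unit[OF order] .

lemma unit_1_minus_q: "local_unit (1 - q)"
  using unit_1_minus_power[of 1] d_gt_1 by simp

text \<open>Since \<open>d\<close> is odd, squaring keeps the order, so the results on blocks also
  apply to the factor with base \<open>q ^ 2\<close>.\<close>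

lemma order_square: "root_order (q ^ 2) d"
  using order odd_d coprime_dvd_mult_right_iff[of d 2]
  by (simp add: root_order_def local_unit_power flip: power_mult)

text \<open>With \<open>P = q ^ d\<close>, \<open>a = d * u\<close> and \<open>b = d * v\<close>,
  the ratio is a quotient of geometric sums in \<open>P\<close> of lengths \<open>u\<close> and
  \<open>v\<close>. Modulo \<open>I 1\<close> the denominator is the positive integer
  \<open>v\<close>, a unit in residue characteristic zero.\<close>

lemma ratio_mem:
  assumes "d dvd a" "d dvd b" "b > 0"
  shows "(1 - q ^ a) / (1 - q ^ b) \<in> I 0"
proof -
  obtain u v where uv: "a = d * u" "b = d * v" using assms by (auto elim!: dvdE)
  define P where "P = q ^ d"
  have P: "1 - P \<in> I 1" "P \<in> I 0" "P \<noteq> 1"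
    using near_1_power[of d] q_mem q_power_neq_1[of d] d_gt_1 by (auto simp: P_def intro: power_mem)
  have "local_unit (of_nat v)" using of_nat_notin[of v] of_nat_mem uv assms by (simp add: local_unit_def)
  moreover have "of_nat v - (\<Sum>i<v. P ^ i) \<in> I 1"
  proof -
    have "of_nat v - (\<Sum>i<v. P ^ i) = (\<Sum>i<v. 1 - P ^ i)" by (simp add: sum_subtractf)
    also have "\<dots> \<in> I 1"
      by (rule sum_mem) (use near_1_power in \<open>simp add: P_def flip: power_mult\<close>)
    finally show ?thesis .
  qed
  ultimately have "local_unit (\<Sum>i<v. P ^ i)" by (rule local_unit_cong)
  then have "(\<Sum>i<u. P ^ i) / (\<Sum>i<v. P ^ i) \<in> I 0"
    by (intro divide_mem sum_mem power_mem P)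
  also have "(\<Sum>i<u. P ^ i) / (\<Sum>i<v. P ^ i) = ((1 - P) * (\<Sum>i<u. P ^ i)) / ((1 - P) * (\<Sum>i<v. P ^ i))"
    using P(3) by simp
  also have "\<dots> = (1 - q ^ a) / (1 - q ^ b)"
    by (simp only: one_diff_power_eq[symmetric]) (simp add: uv P_def power_mult)
  finally show ?thesis .
qed

text \<open>This extends \<open>ratio_mem\<close> to negative exponents: each difference
  \<open>q ^ s - q ^ i\<close> is a unit times \<open>1 - q ^ e\<close>, where \<open>e\<close> is
  the distance from \<open>i\<close> to \<open>s\<close>.\<close>

lemma ratio_mem_shift:
  assumes "d dvd a" "d dvd b" "d dvd s" "b \<noteq> s"
  shows "(1 - q ^ a / q ^ s) / (1 - q ^ b / q ^ s) \<in> I 0"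
proof -
  have diff: "q ^ i - q ^ j = (if i \<le> j then q ^ i * (1 - q ^ (j - i)) else - (q ^ j) * (1 - q ^ (i - j)))" for i j
    by (simp add: algebra_simps flip: power_add)
  have "(1 - q ^ a / q ^ s) / (1 - q ^ b / q ^ s) = (q ^ s - q ^ a) / (q ^ s - q ^ b)"
  proof -
    have *: "1 - q ^ i / q ^ s = (q ^ s - q ^ i) / q ^ s" for i
      using q_nz by (simp add: diff_divide_distrib)
    show ?thesis unfolding * using q_nz by simp
  qed
  moreover have split: "\<exists>u e. local_unit u \<and> d dvd e \<and> q ^ s - q ^ i = u * (1 - q ^ e) \<and> (e = 0 \<longrightarrow> i = s)"
    if "d dvd i" for i
  proof (cases "s \<le> i")
    case True
    then show ?thesis
      unfolding diff[of s i] using that assms(3)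
      by (intro exI[of _ "q ^ s"] exI[of _ "i - s"]) (simp add: local_unit_power q_unit)
  next
    case False
    then show ?thesis
      unfolding diff[of s i] using that assms(3)
      by (intro exI[of _ "- (q ^ i)"] exI[of _ "s - i"]) (simp add: local_unit_power local_unit_minus q_unit)
  qed
  obtain u e where e1: "local_unit u" "d dvd e" "q ^ s - q ^ a = u * (1 - q ^ e)"
    using split[OF assms(1)] by blast
  obtain u' e' where e2: "local_unit u'" "d dvd e'" "q ^ s - q ^ b = u' * (1 - q ^ e')" "e' \<noteq> 0"
    using split[OF assms(2)] assms(4) by metis
  note e = e1 e2
  moreover have "u * (1 - q ^ e) / (u' * (1 - q ^ e')) = u / u' * ((1 - q ^ e) / (1 - q ^ e'))" by simp
  moreover have "u / u' * ((1 - q ^ e) / (1 - q ^ e')) \<in> I 0"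
    using e by (intro mult_mem_0 divide_mem ratio_mem) (auto simp: local_unit_def)
  ultimately show ?thesis by (simp only: e)
qed

text \<open>The form \<open>q ^ i / q ^ s\<close> covers the parameters \<open>1\<close>,
  \<open>q ^ n\<close> and \<open>1 / q ^ n\<close>, and \<open>p = q ^ e\<close> covers the bases
  \<open>q\<close> and \<open>q ^ 2\<close>. The last assumption keeps the critical denominator of
  every block nonzero. Integrality is gained block by block; within a block the shifted parameter is
  congruent to 1.\<close>

lemma poch_ratio_periodic:
  assumes p: "p = q ^ e" "root_order p d" and x: "x = q ^ i / q ^ s" "d dvd i" "d dvd s"
    and s: "\<And>l. i + e * (2 * l + 2) * d \<noteq> s"
  shows "poch_ratio p x (l * d) \<in> I 0"
    and "k < d \<Longrightarrow> poch_ratio p x (l * d + k) - poch_ratio p x (l * d) * poch_ratio p 1 k \<in> I 1"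
proof -
  have p0: "p \<in> I 0" using p(2) by (simp add: root_order_def local_unit_def)
  have x1: "1 - x * p ^ (2 * (l * d)) \<in> I 1" for l
  proof -
    have "1 - q ^ i * (1 / q ^ s) \<in> I 1" by (intro near_1_mult near_1_inverse) (use x near_1_power in auto)
    moreover have "1 - p ^ (2 * (l * d)) \<in> I 1" using p(2) by (simp add: root_order_def)
    ultimately show ?thesis by (intro near_1_mult) (simp_all add: x)
  qed
  show mem: "poch_ratio p x (l * d) \<in> I 0"
  proof (induction l)
    case (Suc l)
    have e: "x * p ^ (2 * (l * d)) * p ^ (j * d) = q ^ (i + e * (2 * l + j) * d) / q ^ s" for j
      by (simp add: x p power_add algebra_simps flip: power_mult)
    have "(1 - x * p ^ (2 * (l * d)) * p ^ (1 * d)) / (1 - x * p ^ (2 * (l * d)) * p ^ (2 * d)) \<in> I 0"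
      unfolding e by (rule ratio_mem_shift) (use x s in auto)
    then have "poch_ratio p (x * p ^ (2 * (l * d))) d \<in> I 0"
      using poch_ratio_block[OF p(2) odd_d x1] by simp
    then have "poch_ratio p x (l * d) * poch_ratio p (x * p ^ (2 * (l * d))) d \<in> I 0"
      using Suc.IH mult_mem_0 by blast
    then show ?case by (simp flip: poch_ratio_add add: add.commute)
  qed (simp add: one_mem)
  assume k: "k < d"
  have "poch_ratio p x (l * d) * (poch_ratio p (x * p ^ (2 * (l * d))) k - poch_ratio p 1 k) \<in> I 1"
    by (intro mult_mem_0 mem poch_ratio_near_1[OF p(2) odd_d x1 k])
  then show "poch_ratio p x (l * d + k) - poch_ratio p x (l * d) * poch_ratio p 1 k \<in> I 1"
    by (simp only: poch_ratio_add right_diff_distrib)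
qed

definition periodic_ratio :: "'a \<Rightarrow> bool" where
  "periodic_ratio x \<longleftrightarrow> (\<forall>l. poch_ratio q x (l * d) \<in> I 0 \<and>
     (\<forall>k<d. poch_ratio q x (l * d + k) - poch_ratio q x (l * d) * poch_ratio q 1 k \<in> I 1))"

lemma periodic_ratio_powers:
  assumes "d dvd n" "odd n"
  shows "periodic_ratio 1" "periodic_ratio (q ^ n)" "periodic_ratio (1 / q ^ n)"
proof -
  have o: "root_order (q ^ 1) d" using order by simp
  show "periodic_ratio 1"
    using poch_ratio_periodic[OF refl o, of 1 0 0] d_gt_1 by (simp add: periodic_ratio_def)
  show "periodic_ratio (q ^ n)"
    using poch_ratio_periodic[OF refl o, of "q ^ n" n 0] d_gt_1 assms by (simp add: periodic_ratio_def)
  \<comment> \<open>The critical denominator exponents are even multiples of \<open>d\<close>, hence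
    never the odd number \<open>n\<close>.\<close>
  have "0 + 1 * (2 * l + 2) * d \<noteq> n" for l
  proof
    assume *: "0 + 1 * (2 * l + 2) * d = n"
    have "even (0 + 1 * (2 * l + 2) * d)" by simp
    then show False using assms(2) unfolding * by blast
  qed
  then show "periodic_ratio (1 / q ^ n)"
    using poch_ratio_periodic[OF refl o, of "1 / q ^ n" 0 n] d_gt_1 assms by (simp add: periodic_ratio_def)
qed

lemma poch_ratio_1_mem: "k < d \<Longrightarrow> poch_ratio q 1 k \<in> I 0" "k < d \<Longrightarrow> poch_ratio (q ^ 2) 1 k \<in> I 0"
  using poch_ratio_mem[OF order odd_d, of 1] poch_ratio_mem[OF order_square odd_d, of 1] zero_mem by auto

text \<open>The multiplier \<open>A\<close> collects the power of \<open>- q\<close> and all ratios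
  at \<open>l * d\<close>. The q-integer contributes nothing to it, because
  \<open>q ^ (4 * l * d)\<close> is congruent to 1.\<close>

lemma wp_term_periodic:
  assumes "periodic_ratio x" "periodic_ratio (1 / x)" "periodic_ratio y" "periodic_ratio (1 / y)"
  shows "\<exists>A\<in>I 0. \<forall>k<d. wp_term q x y (l * d + k) - A * wp_term q 1 1 k \<in> I 1"
proof -
  define A where "A = (- q) ^ (l * d) * poch_ratio (q ^ 2) 1 (l * d)
     * (poch_ratio q x (l * d) * poch_ratio q (1 / x) (l * d)) * (poch_ratio q y (l * d) * poch_ratio q (1 / y) (l * d))"
  have "1 = q ^ 0 / q ^ 0" "d dvd 0" "0 + 2 * (2 * l + 2) * d \<noteq> 0" for l
    using d_gt_1 by simp_all
  note sq = poch_ratio_periodic[OF refl order_square this(1,2,2,3)]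
  have r: "poch_ratio q z (l * d) \<in> I 0" if "periodic_ratio z" for z
    using that by (simp add: periodic_ratio_def)
  have pw: "(- q) ^ i \<in> I 0" for i by (intro power_mem minus_mem q_mem)
  have "A \<in> I 0"
    unfolding A_def by (intro mult_mem_0 r assms pw sq)
  moreover have "wp_term q x y (l * d + k) - A * wp_term q 1 1 k \<in> I 1" if k: "k < d" for k
  proof -
    define B where "B = (\<lambda>z. poch_ratio q z (l * d) * poch_ratio q 1 k)"
    have B: "B z \<in> I 0" "poch_ratio q z (l * d + k) - B z \<in> I 1" "poch_ratio q z (l * d + k) \<in> I 0"
      if "periodic_ratio z" for z
    proof -
      show *: "B z \<in> I 0" unfolding B_def by (intro mult_mem_0 r that poch_ratio_1_mem k)
      show **: "poch_ratio q z (l * d + k) - B z \<in> I 1"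
        using that k by (simp add: periodic_ratio_def B_def)
      show "poch_ratio q z (l * d + k) \<in> I 0"
        using add_mem[OF * mem_0[OF **]] by simp
    qed
    have sq': "poch_ratio (q ^ 2) 1 (l * d) * poch_ratio (q ^ 2) 1 k \<in> I 0"
      by (intro mult_mem_0 sq poch_ratio_1_mem k)
    have sq'': "poch_ratio (q ^ 2) 1 (l * d + k) \<in> I 0"
      using add_mem[OF sq' mem_0[OF sq(2)[OF k, of l]]] by simp
    have v: "(1 - q ^ i) / (1 - q) \<in> I 0" for i
      by (intro divide_mem unit_1_minus_q diff_mem one_mem power_mem q_mem)
    have vd: "(1 - q ^ (4 * (l * d + k) + 1)) / (1 - q) - (1 - q ^ (4 * k + 1)) / (1 - q) \<in> I 1"
    proof -
      have "(1 - q ^ (4 * (l * d + k) + 1)) - (1 - q ^ (4 * k + 1)) = q ^ (4 * k + 1) * (1 - q ^ (4 * l * d))"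
        by (simp add: algebra_simps flip: power_add power_Suc)
      also have "\<dots> \<in> I 1" by (intro mult_mem_0 power_mem q_mem) (simp add: near_1_power[unfolded One_nat_def])
      finally show ?thesis
        unfolding diff_divide_distrib[symmetric] by (rule divide_mem[OF _ unit_1_minus_q])
    qed
    have z: "(- q) ^ (l * d + k) - (- q) ^ (l * d + k) \<in> I 1" by (simp add: zero_mem)
    have "wp_term q x y (l * d + k) - ((1 - q ^ (4 * k + 1)) / (1 - q) * (- q) ^ (l * d + k)
      * (poch_ratio (q ^ 2) 1 (l * d) * poch_ratio (q ^ 2) 1 k) * (B x * B (1 / x)) * (B y * B (1 / y))) \<in> I 1"
      unfolding wp_term_def
      by (intro mult_diff_mem vd z sq(2) k B assms v pw sq' sq'' mult_mem_0)
    also have "(1 - q ^ (4 * k + 1)) / (1 - q) * (- q) ^ (l * d + k)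
      * (poch_ratio (q ^ 2) 1 (l * d) * poch_ratio (q ^ 2) 1 k) * (B x * B (1 / x)) * (B y * B (1 / y))
      = A * wp_term q 1 1 k"
      by (simp add: A_def wp_term_def B_def power_add mult_ac)
    finally show ?thesis .
  qed
  ultimately show ?thesis by blast
qed

lemma unit_1_minus_even_power: "0 < k \<Longrightarrow> k < d \<Longrightarrow> local_unit (1 - q ^ (2 * k))"
  using odd_d coprime_dvd_mult_right_iff[of d 2 k] by (intro unit_1_minus_power) (auto dest: dvd_imp_le)

text \<open>If \<open>d\<close> is 3 modulo 4, the sum is zero by the factor at \<open>i = 0\<close>
  of the product formula. If \<open>d\<close> is 1 modulo 4, which can happen for a divisor of
  \<open>n\<close>, induction from exponent 1 in steps of 4 shows that the sum is
  \<open>1 - q ^ d\<close> times an integral element.\<close>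

lemma base_sum_mem:
  assumes "d < 2 * K"
  shows "(\<Sum>k<K. wp_term q (q ^ d) 1 k) \<in> I 1"
proof -
  have y: "(1::'a) \<noteq> 0" "1 - 1 * q ^ (2 * k + 2) \<noteq> 0" "1 - 1 / 1 * q ^ (2 * k + 2) \<noteq> 0" for k
    using q_power_neq_1[of "2 * k + 2"] by simp_all
  have "d mod 4 = 3 \<or> d mod 4 = 1" using odd_d by presburger
  then consider "d mod 4 = 3" | "d mod 4 = 1" by blast
  then show ?thesis
  proof cases
    case 1
    define m where "m = d div 4"
    have d: "d = 4 * m + 3" unfolding m_def using 1 by presburger
    have "(\<Sum>k<K. wp_term q (q ^ (4 * m + 3)) 1 k) = 0"
      unfolding wp_sum_3_mod_4[OF y assms[unfolded d]] by (simp only: prod.lessThan_Suc_shift) simp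
    then have "(\<Sum>k<K. wp_term q (q ^ d) 1 k) = 0" by (simp only: d)
    then show ?thesis by (simp add: zero_mem)
  next
    case 2
    have "\<exists>r\<in>I 0. (\<Sum>k<K. wp_term q (q ^ (4 * m + 1)) 1 k) = (1 - q ^ (4 * m + 1)) * r"
      if "4 * m + 1 \<le> d" for m
      using that
    proof (induction m)
      case 0
      have "(\<Sum>k<K. wp_term q (q ^ 1) 1 k) = (\<Sum>k<1. wp_term q (q ^ 1) 1 k)"
        by (rule wp_sum_restrict) (use assms d_gt_1 in auto)
      also have "\<dots> = (1 - q) * (1 / (1 - q))"
        using q_power_neq_1[of 1] by (simp add: wp_term_0)
      finally show ?case
        using divide_mem[OF one_mem unit_1_minus_q] by (intro bexI[of _ "1 / (1 - q)"]) simp_all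
    next
      case (Suc m)
      define n where "n = 4 * m + 1"
      obtain r where r: "r \<in> I 0" "(\<Sum>k<K. wp_term q (q ^ n) 1 k) = (1 - q ^ n) * r"
        unfolding n_def using Suc by auto
      have n: "odd n" "n + 4 < 2 * K" "n + 4 \<le> d" "n + 4 = 4 * Suc m + 1" "n + 3 = 2 * (2 * m + 2)"
        using assms Suc.prems by (auto simp: n_def)
      \<comment> \<open>The exponent is even and its half lies strictly between 0 and
        \<open>d\<close>; this keeps the multiplier \<open>?t\<close> integral throughout the
        induction.\<close>
      have u: "local_unit (1 - q ^ (n + 3))"
        unfolding n(5) by (rule unit_1_minus_even_power) (use n n_def in auto)
      have nz: "1 - q ^ n \<noteq> 0" using q_power_neq_1[of n] by (simp add: n_def)
      let ?t = "(1 - q ^ (n + 1)) / (1 - q ^ (n + 3))"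
      have "S = b * (r * ((c / e) * (c / e)))" if "S * a * (e * e) = a * r * b * (c * c)" "a \<noteq> 0" "e \<noteq> 0"
        for S a b c e :: 'a
      proof -
        have "S = a * r * b * (c * c) / (a * (e * e))"
          using that by (simp add: field_simps)
        also have "\<dots> = b * (r * ((c / e) * (c / e)))" using that by simp
        finally show ?thesis .
      qed
      note this[OF _ nz local_unit_nz[OF u]]
      from this[OF wp_sum_step[OF y n(1,2), unfolded r(2), unfolded mult_1_right div_by_1]]
      have "(\<Sum>k<K. wp_term q (q ^ (n + 4)) 1 k) = (1 - q ^ (n + 4)) * (r * (?t * ?t))" .
      moreover have "r * (?t * ?t) \<in> I 0"
        by (intro mult_mem_0 r(1) divide_mem u diff_mem one_mem power_mem q_mem)
      ultimately show ?case unfolding n(4) by blast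
    qed
    moreover have "d = 4 * (d div 4) + 1" using 2 by presburger
    ultimately obtain r where r: "r \<in> I 0" "(\<Sum>k<K. wp_term q (q ^ d) 1 k) = (1 - q ^ d) * r"
      by (metis order_refl)
    have "1 - q ^ d \<in> I 1" using near_1_power[of d] by simp
    then show ?thesis unfolding r(2) using r(1) by (rule mult_mem_0')
  qed
qed

definition near_pair :: "'a \<Rightarrow> nat \<Rightarrow> 'a" where
  "near_pair x k = poch_ratio q x k * poch_ratio q (1 / x) k"

lemma near_pair_mem: "1 - x \<in> I 1 \<Longrightarrow> k < d \<Longrightarrow> near_pair x k \<in> I 0"
  unfolding near_pair_def
  by (intro mult_mem_0 poch_ratio_mem[OF order odd_d] near_1_inverse) auto

text \<open>Since \<open>(1 - z)\<^sup>2 - (1 - x z) (1 - z / x) = z (1 - x)\<^sup>2 / x\<close>, the pair is stationary at \<open>x = 1\<close>.\<close>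

lemma near_pair_diff_mem:
  assumes x: "1 - x \<in> I 1" and k: "k < d"
  shows "near_pair 1 k - near_pair x k \<in> I 2"
proof -
  have u: "local_unit x" by (rule near_1_unit[OF x])
  have x0: "x \<in> I 0" "1 / x \<in> I 0" "1 \<in> I 0" "q \<in> I 0"
    using near_1_unit[OF near_1_inverse[OF x]] u one_mem q_mem by (auto simp: local_unit_def)
  define N where "N = (\<lambda>x i. (1 - x * q ^ i) * (1 - 1 / x * q ^ i))"
  have pair: "near_pair x k = (\<Prod>j<k. N x (2 * j + 1) / N x (2 * j + 2))" for x
    by (simp add: near_pair_def poch_ratio_def N_def flip: prod.distrib)
  have N0: "N x i \<in> I 0" "N 1 i \<in> I 0" for i
    unfolding N_def div_by_1 by (intro mult_mem_0 diff_mem power_mem x0)+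
  have Nd: "N 1 i - N x i \<in> I 2" for i
  proof -
    have "N 1 i - N x i = q ^ i * (1 / x) * ((1 - x) * (1 - x))"
      unfolding N_def using local_unit_nz[OF u] by (simp add: field_simps)
    moreover have "(1 - x) * (1 - x) \<in> I 2"
      using mult_mem[OF x x] by (simp add: numeral_2_eq_2)
    moreover have "q ^ i * (1 / x) \<in> I 0"
      by (intro mult_mem_0 power_mem x0)
    ultimately show ?thesis
      using mult_mem_0 by presburger
  qed
  have Nu: "local_unit (N x (2 * j + 2))" if j: "j < k" and x: "1 - x \<in> I 1" for j x
  proof -
    have "\<not> d dvd 2 * j + 2"
      using coprime_dvd_mult_right_iff[of d 2 "j+1"] odd_d j k by (auto dest: dvd_imp_le)
    then show ?thesis
      unfolding N_def by (intro local_unit_mult near_1_unit_shift[OF order] x near_1_inverse)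
  qed
  have 1: "1 - 1 \<in> I 1" by (simp add: zero_mem)
  show ?thesis
    unfolding pair
    by (rule prod_diff_mem) (intro divide_mem divide_diff_mem N0 Nd Nu x 1; assumption)+
qed

lemma wp_term_near_pair:
  "wp_term q x y k = (1 - q ^ (4 * k + 1)) / (1 - q) * (- q) ^ k * poch_ratio (q ^ 2) 1 k
     * (near_pair x k * near_pair y k)"
  by (simp add: wp_term_def near_pair_def mult.assoc)

lemma coeff_mem:
  "k < d \<Longrightarrow> (1 - q ^ (4 * k + 1)) / (1 - q) * (- q) ^ k * poch_ratio (q ^ 2) 1 k \<in> I 0"
  by (intro mult_mem_0 divide_mem unit_1_minus_q diff_mem one_mem power_mem minus_mem q_mem poch_ratio_1_mem)

text \<open>For \<open>k < d\<close>, replacing \<open>x = 1\<close> by \<open>x = q ^ d\<close>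
  changes the term only by an element of \<open>I 1\<close>, and the resulting terminating sum is
  covered by \<open>base_sum_mem\<close>. The range of \<open>K\<close> includes both the half block
  \<open>(d + 1) div 2\<close> and the full block \<open>d\<close>.\<close>

lemma first_block_mem:
  assumes "d < 2 * K" "K \<le> d"
  shows "(\<Sum>k<K. wp_term q 1 1 k) \<in> I 1"
proof -
  have qd: "1 - q ^ d \<in> I 1" using near_1_power[of d] by simp
  have factor: "c * (a * a) - c * (b * a) = c * ((a - b) * a)" for a b c :: 'a
    by (simp add: algebra_simps)
  have "wp_term q 1 1 k - wp_term q (q ^ d) 1 k \<in> I 1" if "k < d" for k
  proof -
    have "wp_term q 1 1 k - wp_term q (q ^ d) 1 k = (1 - q ^ (4 * k + 1)) / (1 - q) * (- q) ^ k
      * poch_ratio (q ^ 2) 1 k * ((near_pair 1 k - near_pair (q ^ d) k) * near_pair 1 k)"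
      unfolding wp_term_near_pair by (rule factor)
    also have "\<dots> \<in> I 1"
      using mem_antimono[OF near_pair_diff_mem[OF qd that], of 1]
      by (intro mult_mem_0 mult_mem_0' coeff_mem near_pair_mem that) (auto simp: zero_mem)
    finally show ?thesis .
  qed
  then have "(\<Sum>k<K. wp_term q 1 1 k - wp_term q (q ^ d) 1 k) \<in> I 1"
    using assms by (intro sum_mem) auto
  from add_mem[OF this base_sum_mem[OF assms(1)]] show ?thesis
    by (simp add: sum_subtractf)
qed

text \<open>Each of the \<open>L\<close> full blocks, and the remaining partial block of length
  \<open>r\<close>, is congruent to an integral multiple of an initial sum covered by
  \<open>first_block_mem\<close>.\<close>

lemma wp_sum_mem:
  assumes xy: "periodic_ratio x" "periodic_ratio (1 / x)" "periodic_ratio y" "periodic_ratio (1 / y)"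
    and r: "r = 0 \<or> (d < 2 * r \<and> r \<le> d)"
  shows "(\<Sum>k<L * d + r. wp_term q x y k) \<in> I 1"
proof -
  have block: "(\<Sum>k<r. wp_term q x y (l * d + k)) \<in> I 1" if r: "r = 0 \<or> (d < 2 * r \<and> r \<le> d)" for l r
  proof (cases "r = 0")
    case False
    obtain A where A: "A \<in> I 0" "\<And>k. k < d \<Longrightarrow> wp_term q x y (l * d + k) - A * wp_term q 1 1 k \<in> I 1"
      using wp_term_periodic[OF xy] by metis
    have "(\<Sum>k<r. wp_term q x y (l * d + k) - A * wp_term q 1 1 k) \<in> I 1"
      by (rule sum_mem) (use A r False in auto)
    moreover have "A * (\<Sum>k<r. wp_term q 1 1 k) \<in> I 1"
      by (intro mult_mem_0 A first_block_mem) (use r False in auto)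
    ultimately have "(\<Sum>k<r. wp_term q x y (l * d + k) - A * wp_term q 1 1 k) + A * (\<Sum>k<r. wp_term q 1 1 k) \<in> I 1"
      by (rule add_mem)
    then show ?thesis by (simp add: sum_subtractf sum_distrib_left)
  qed (simp add: zero_mem)
  have "(\<Sum>k<L * d. wp_term q x y k) \<in> I 1"
  proof (induction L)
    case (Suc L)
    have "(\<Sum>k<L * d + d. wp_term q x y k) \<in> I 1"
      unfolding sum_lessThan_add by (intro add_mem Suc block) (use d_gt_1 in simp)
    then show ?case by (simp add: add.commute)
  qed (simp add: zero_mem)
  then show ?thesis unfolding sum_lessThan_add by (intro add_mem block r)
qed

end

section \<open>Local congruences\<close>

context generic_base
begin

lemma wp_diagonal_sum:
  assumes n: "n = 4 * m + 3" and K: "n < 2 * K"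
  shows "(\<Sum>k<K. wp_term q (q ^ n) (q ^ n) k) = - q * ((1 - q ^ n) / (1 - q))
    * (\<Prod>i<Suc m. (1 - q ^ (4 * i) * q ^ n) * (1 - q ^ (4 * i) / q ^ n)
        / ((1 - q ^ (4 * i + 2) * q ^ n) * (1 - q ^ (4 * i + 2) / q ^ n)))"
proof -
  have 1: "1 - q ^ n * q ^ (2 * k + 2) \<noteq> 0" for k
    using q_power_neq_1[of "n + (2 * k + 2)"] by (simp add: power_add mult_ac)
  have 2: "1 - 1 / q ^ n * q ^ (2 * k + 2) \<noteq> 0" for k
  proof
    assume "1 - 1 / q ^ n * q ^ (2 * k + 2) = 0"
    then have "q ^ n = q ^ (2 * k + 2)" using q_nz by (simp add: field_simps)
    then show False unfolding q_power_cancel n by presburger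
  qed
  show ?thesis
    using wp_sum_3_mod_4[of "q ^ n", OF _ 1 2, of m K] K q_nz by (simp add: n)
qed

text \<open>With \<open>n = 4 * m + 3\<close>, the factors containing \<open>q ^ n\<close> as a
  multiplier are the upper halves of the sequences \<open>a\<close> and \<open>b\<close>, and those
  divided by \<open>q ^ n\<close> are, in reverse order, the lower halves up to powers of
  \<open>q\<close>. Together they form the two q-Pochhammer symbols and one further factor
  \<open>1 - q ^ n\<close>.\<close>

lemma wp_diagonal_sum_qpoch:
  assumes n: "n mod 4 = 3" and K: "n < 2 * K"
  shows "((1 - q ^ n) / (1 - q)) ^ 2 * q ^ ((1 + n) div 2)
      * (qpoch (q ^ 3) (q ^ 4) ((n - 1) div 2) / qpoch (q ^ 5) (q ^ 4) ((n - 1) div 2))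
    = - (q ^ n) * (\<Sum>k<K. wp_term q (q ^ n) (q ^ n) k)"
proof -
  define m where "m = n div 4"
  have nm: "n = 4 * m + 3" using n unfolding m_def by presburger
  have N: "(n - 1) div 2 = 2 * m + 1" "(1 + n) div 2 = 2 * Suc m" by (simp_all add: nm)
  define a where "a = (\<lambda>i. 1 - q ^ (4 * i + 3))"
  define b where "b = (\<lambda>i. 1 - q ^ (4 * i + 1))"
  have a0: "a i \<noteq> 0" and b0: "b i \<noteq> 0" for i
    using q_power_neq_1[of "4 * i + 3"] q_power_neq_1[of "4 * i + 1"] by (simp_all add: a_def b_def)
  have qa: "qpoch (q ^ 3) (q ^ 4) (2 * m + 1) = (\<Prod>i<2 * m + 1. a i)"
  proof -
    have "4 * i + 3 = 3 + 4 * i" for i :: nat by simp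
    then show ?thesis
      unfolding qpoch_def a_def by (simp only: power_add power_mult)
  qed
  have qb: "qpoch (q ^ 5) (q ^ 4) (2 * m + 1) = (\<Prod>i<2 * m + 1. b (Suc i))"
  proof -
    have "4 * Suc i + 1 = 5 + 4 * i" for i by simp
    then show ?thesis
      unfolding qpoch_def b_def by (simp only: power_add power_mult)
  qed
  have split: "(\<Prod>i<k + l. f i) = (\<Prod>i<k. f i) * (\<Prod>i<l. f (k + i))" for f :: "nat \<Rightarrow> 'a" and k l
    by (induction l) (simp_all add: mult.assoc)
  have A1: "(\<Prod>i<Suc m. 1 - q ^ (4 * i) * q ^ n) = (1 - q ^ n) * (\<Prod>i<m. a (Suc m + i))"
    unfolding prod.lessThan_Suc_shift by (simp add: a_def nm mult_ac flip: power_add)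
  have A2: "(\<Prod>i<Suc m. 1 - q ^ (4 * i + 2) * q ^ n) = (\<Prod>i<Suc m. b (Suc m + i))"
  proof -
    have "b (Suc m + i) = 1 - q ^ (4 * i + 2) * q ^ n" for i
    proof -
      have "4 * (Suc m + i) + 1 = 4 * i + 2 + n" by (simp add: nm)
      then show ?thesis by (simp only: b_def power_add[of q "4 * i + 2" n])
    qed
    then show ?thesis by (simp only:)
  qed
  \<comment> \<open>Reversing the order turns the exponents into \<open>- (4 * i + 3)\<close> and
    \<open>- (4 * i + 1)\<close>; rewriting each with a positive exponent costs \<open>q ^ 2\<close>
    per quotient.\<close>
  have A3: "(\<Prod>i<Suc m. (1 - q ^ (4 * i) / q ^ n) / (1 - q ^ (4 * i + 2) / q ^ n))
     = (\<Prod>i<Suc m. a i / b i / q ^ 2)"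
  proof -
    have "(\<Prod>i<Suc m. (1 - q ^ (4 * i) / q ^ n) / (1 - q ^ (4 * i + 2) / q ^ n))
      = (\<Prod>i<Suc m. (1 - q ^ (4 * (Suc m - Suc i)) / q ^ n) / (1 - q ^ (4 * (Suc m - Suc i) + 2) / q ^ n))"
      by (rule prod.nat_diff_reindex[symmetric])
    also have "\<dots> = (\<Prod>i<Suc m. a i / b i / q ^ 2)"
    proof (intro prod.cong refl)
      fix i assume i: "i \<in> {..<Suc m}"
      have "n = 4 * (Suc m - Suc i) + (4 * i + 3)" "n = 4 * (Suc m - Suc i) + 2 + (4 * i + 1)"
        using i by (auto simp: nm)
      then have e: "q ^ n = q ^ (4 * (Suc m - Suc i)) * q ^ (4 * i + 3)"
        "q ^ n = q ^ (4 * (Suc m - Suc i) + 2) * q ^ (4 * i + 1)"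
        by (metis power_add)+
      have "1 - q ^ (4 * (Suc m - Suc i)) / q ^ n = - (a i / q ^ (4 * i + 3))"
        unfolding e(1) a_def using q_nz by (simp add: field_simps)
      moreover have "1 - q ^ (4 * (Suc m - Suc i) + 2) / q ^ n = - (b i / q ^ (4 * i + 1))"
        unfolding e(2) b_def using q_nz by (simp add: field_simps)
      moreover have "q ^ (4 * i + 3) = q ^ (4 * i + 1) * q ^ 2" by (simp add: eval_nat_numeral)
      ultimately show "(1 - q ^ (4 * (Suc m - Suc i)) / q ^ n) / (1 - q ^ (4 * (Suc m - Suc i) + 2) / q ^ n) = a i / b i / q ^ 2"
        using q_nz by simp
    qed
    finally show ?thesis .
  qed
  have "(\<Prod>i<Suc m. (1 - q ^ (4 * i) * q ^ n) * (1 - q ^ (4 * i) / q ^ n)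
        / ((1 - q ^ (4 * i + 2) * q ^ n) * (1 - q ^ (4 * i + 2) / q ^ n)))
     = (\<Prod>i<Suc m. 1 - q ^ (4 * i) * q ^ n) / (\<Prod>i<Suc m. 1 - q ^ (4 * i + 2) * q ^ n)
      * (\<Prod>i<Suc m. (1 - q ^ (4 * i) / q ^ n) / (1 - q ^ (4 * i + 2) / q ^ n))"
    by (simp only: prod_dividef[symmetric] prod.distrib[symmetric] times_divide_times_eq)
  also have "\<dots> = (1 - q ^ n) * (\<Prod>i<m. a (Suc m + i)) / (\<Prod>i<Suc m. b (Suc m + i))
      * ((\<Prod>i<Suc m. a i) / (\<Prod>i<Suc m. b i) / q ^ (2 * Suc m))"
  proof -
    have "(\<Prod>i<Suc m. a i / b i / q ^ 2) = (\<Prod>i<Suc m. a i) / (\<Prod>i<Suc m. b i) / q ^ (2 * Suc m)"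
      unfolding prod_dividef prod_constant card_lessThan by (simp only: power_mult)
    then show ?thesis by (simp only: A1 A2 A3)
  qed
  also have "\<dots> = (1 - q ^ n) * ((\<Prod>i<Suc m. a i) * (\<Prod>i<m. a (Suc m + i)))
      / ((\<Prod>i<Suc m. b i) * (\<Prod>i<Suc m. b (Suc m + i))) / q ^ (2 * Suc m)"
    by (simp only: times_divide_times_eq times_divide_eq_right divide_divide_eq_left mult_ac)
  also have "(\<Prod>i<Suc m. a i) * (\<Prod>i<m. a (Suc m + i)) = (\<Prod>i<2 * m + 1. a i)"
    using split[of a "Suc m" m] by (simp only: mult_2 add_Suc Suc_eq_plus1[symmetric])
  also have "(\<Prod>i<Suc m. b i) * (\<Prod>i<Suc m. b (Suc m + i)) = b 0 * (\<Prod>i<2 * m + 1. b (Suc i))"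
  proof -
    have e: "Suc m + Suc m = Suc (2 * m + 1)" by simp
    show ?thesis unfolding split[symmetric] e by (rule prod.lessThan_Suc_shift)
  qed
  also have "b 0 = 1 - q" by (simp add: b_def)
  finally have P: "(\<Prod>i<Suc m. (1 - q ^ (4 * i) * q ^ n) * (1 - q ^ (4 * i) / q ^ n)
        / ((1 - q ^ (4 * i + 2) * q ^ n) * (1 - q ^ (4 * i + 2) / q ^ n)))
     = (1 - q ^ n) * (\<Prod>i<2 * m + 1. a i) / ((1 - q) * (\<Prod>i<2 * m + 1. b (Suc i))) / q ^ (2 * Suc m)" .
  \<comment> \<open>This accounts for the power in the statement: \<open>q ^ n * q\<close> divided
    by \<open>q ^ (2 * Suc m)\<close> is \<open>q ^ ((1 + n) div 2)\<close>.\<close>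
  have qn: "q ^ n * q = q ^ (2 * Suc m) * q ^ (2 * Suc m)"
  proof -
    have "n + 1 = 2 * Suc m + 2 * Suc m" by (simp add: nm)
    then have "q ^ (n + 1) = q ^ (2 * Suc m + 2 * Suc m)" by (simp only:)
    then show ?thesis by (simp only: power_add power_one_right)
  qed
  have alg: "(t / h) ^ 2 * Q * (A / B) = - Qn * (- q * (t / h) * (t * A / (h * B) / Q))"
    if "Qn * q = Q * Q" "Q \<noteq> 0" for t h Q Qn A B :: 'a
  proof -
    have "- Qn * (- q * (t / h) * (t * A / (h * B) / Q)) = (Qn * q) * (t / h) * (t * A / (h * B)) / Q"
      by (simp add: mult_ac)
    also have "\<dots> = Q * (t / h) * (t * A / (h * B))" unfolding that(1) using that(2) by simp
    finally show ?thesis by (simp add: power2_eq_square mult_ac)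
  qed
  show ?thesis
    unfolding wp_diagonal_sum[OF nm K] P N qa qb by (rule alg[OF qn]) (simp add: q_nz)
qed

end

context filtered_base
begin

text \<open>One order of vanishing comes from the prefactor \<open>1 - q ^ d\<close> and two more
  from the factor at \<open>i = 0\<close>, whose numerator is
  \<open>(1 - q ^ d) * (1 - 1 / q ^ d)\<close>. All denominators are units because
  \<open>0 < 2 * i + 1 < d\<close>.\<close>

lemma wp_diagonal_sum_mem_3:
  assumes n: "d mod 4 = 3" and K: "d < 2 * K"
  shows "(\<Sum>k<K. wp_term q (q ^ d) (q ^ d) k) \<in> I 3"
proof -
  define m where "m = d div 4"
  have nm: "d = 4 * m + 3" using n unfolding m_def by presburger
  define F where "F = (\<lambda>i. (1 - q ^ (4 * i) * q ^ d) * (1 - q ^ (4 * i) / q ^ d)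
        / ((1 - q ^ (4 * i + 2) * q ^ d) * (1 - q ^ (4 * i + 2) / q ^ d)))"
  have qd: "1 - q ^ d \<in> I 1" "1 - 1 / q ^ d \<in> I 1"
    using near_1_power[of d] near_1_inverse[of "q ^ d"] by simp_all
  have inv: "1 / q ^ d \<in> I 0"
    using near_1_unit[OF qd(2)] by (simp add: local_unit_def)
  have den: "local_unit ((1 - q ^ (4 * i + 2) * q ^ d) * (1 - q ^ (4 * i + 2) / q ^ d))" if "i \<le> m" for i
  proof (rule local_unit_mult)
    have "\<not> d dvd 4 * i + 2"
      using unit_1_minus_even_power[of "2 * i + 1"] near_1_power[of "4 * i + 2"] that nm
      by (simp add: local_unit_def)
    then have "local_unit (1 - x * q ^ (4 * i + 2))" if "1 - x \<in> I 1" for x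
      using near_1_unit_shift[OF order _ that] by blast
    from this[OF qd(1)] this[OF qd(2)]
    show "local_unit (1 - q ^ (4 * i + 2) * q ^ d)" "local_unit (1 - q ^ (4 * i + 2) / q ^ d)"
      by (simp_all add: mult.commute)
  qed
  have F: "F i \<in> I 0" if "i \<le> m" for i
    unfolding F_def
  proof (intro divide_mem den that mult_mem_0)
    have "1 - q ^ (4 * i) * (1 / q ^ d) \<in> I 0"
      by (intro diff_mem one_mem mult_mem_0 power_mem q_mem inv)
    then show "1 - q ^ (4 * i) / q ^ d \<in> I 0" by simp
  qed (intro diff_mem one_mem mult_mem_0 power_mem q_mem)
  have F0: "F 0 \<in> I 2"
  proof -
    have "(1 - q ^ d) * (1 - 1 / q ^ d) \<in> I 2"
      using mult_mem[OF qd] by (simp add: numeral_2_eq_2)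
    from divide_mem[OF this den[of 0]] show ?thesis by (simp add: F_def)
  qed
  have "(\<Sum>k<K. wp_term q (q ^ d) (q ^ d) k) = - q * ((1 - q ^ d) / (1 - q)) * (\<Prod>i<Suc m. F i)"
    unfolding F_def by (rule wp_diagonal_sum[OF nm K])
  also have "\<dots> = (1 - q ^ d) * F 0 * (- q * (1 / (1 - q)) * (\<Prod>i<m. F (Suc i)))"
    by (simp only: prod.lessThan_Suc_shift) simp
  also have "\<dots> \<in> I 3"
  proof (rule mult_mem_0')
    show "(1 - q ^ d) * F 0 \<in> I 3" using mult_mem[OF qd(1) F0] by (simp add: eval_nat_numeral)
    show "- q * (1 / (1 - q)) * (\<Prod>i<m. F (Suc i)) \<in> I 0"
      by (intro mult_mem_0 prod_mem F divide_mem minus_mem q_mem one_mem unit_1_minus_q) simp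
  qed
  finally show ?thesis .
qed

text \<open>The mixed second difference of the sum in its two parameters vanishes to fourth order, so
  the value at \<open>(1, 1)\<close> is determined by the terminating values at \<open>(q^d, 1)\<close> and \<open>(q^d, q^d)\<close>.\<close>

lemma wp_sum_mod_4:
  assumes n: "d mod 4 = 3" and K: "d < 2 * K" "K \<le> d"
  shows "(\<Sum>k<K. wp_term q 1 1 k) + q ^ d * (\<Sum>k<K. wp_term q (q ^ d) (q ^ d) k) \<in> I 4"
proof -
  have qd: "1 - q ^ d \<in> I 1" using near_1_power[of d] by simp
  let ?f = "\<Sum>k<K. wp_term q (q ^ d) (q ^ d) k"
  define m where "m = d div 4"
  have nm: "d = 4 * m + 3" using n unfolding m_def by presburger
  have y: "(1::'a) \<noteq> 0" "1 - 1 * q ^ (2 * k + 2) \<noteq> 0" "1 - 1 / 1 * q ^ (2 * k + 2) \<noteq> 0" for k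
    using q_power_neq_1[of "2 * k + 2"] by simp_all
  have mixed: "(\<Sum>k<K. wp_term q (q ^ d) 1 k) = 0"
    using wp_sum_3_mod_4[OF y K(1)[unfolded nm]]
    unfolding nm[symmetric] prod.lessThan_Suc_shift by simp
  have factor: "c * (a * a) - 2 * (c * (b * a)) + c * (b * b) = c * ((a - b) * (a - b))" for a b c :: 'a
    by (simp add: algebra_simps)
  have "wp_term q 1 1 k - 2 * wp_term q (q ^ d) 1 k + wp_term q (q ^ d) (q ^ d) k \<in> I 4" if "k < K" for k
  proof -
    have k: "k < d" using that K by simp
    have "(near_pair 1 k - near_pair (q ^ d) k) * (near_pair 1 k - near_pair (q ^ d) k) \<in> I 4"
      using mult_mem[OF near_pair_diff_mem[OF qd k] near_pair_diff_mem[OF qd k]] by simp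
    then show ?thesis
      unfolding wp_term_near_pair factor by (intro mult_mem_0[OF coeff_mem[OF k]])
  qed
  then have "(\<Sum>k<K. wp_term q 1 1 k - 2 * wp_term q (q ^ d) 1 k + wp_term q (q ^ d) (q ^ d) k) \<in> I 4"
    by (intro sum_mem) simp
  then have "(\<Sum>k<K. wp_term q 1 1 k) + ?f \<in> I 4"
    using mixed by (simp add: sum.distrib sum_subtractf flip: sum_distrib_left)
  \<comment> \<open>The second difference yields the coefficient 1 for \<open>?f\<close>, whereas
    \<open>q ^ d\<close> is wanted. The correction is small enough because \<open>?f\<close> already
    lies in \<open>I 3\<close>.\<close>
  moreover have "(1 - q ^ d) * ?f \<in> I 4"
    using mult_mem[OF qd wp_diagonal_sum_mem_3[OF n K(1)]] by (simp add: eval_nat_numeral)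
  ultimately have "(\<Sum>k<K. wp_term q 1 1 k) + ?f - (1 - q ^ d) * ?f \<in> I 4"
    by (rule diff_mem)
  then show ?thesis by (simp add: algebra_simps)
qed

text \<open>Both sums vanish modulo \<open>I 1\<close> separately, since either choice of
  \<open>K\<close> consists of full blocks and possibly a half block of length
  \<open>(d + 1) div 2\<close>.\<close>

lemma wp_sum_mod_1:
  assumes n: "d dvd n" "odd n" and K: "K = n \<or> K = (n + 1) div 2"
  shows "(\<Sum>k<K. wp_term q 1 1 k) + q ^ n * (\<Sum>k<K. wp_term q (q ^ n) (q ^ n) k) \<in> I 1"
proof -
  obtain e where e: "n = d * e" using n(1) by (rule dvdE)
  have "\<exists>L r. K = L * d + r \<and> (r = 0 \<or> (d < 2 * r \<and> r \<le> d))"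
    using K
  proof
    assume "K = n"
    then show ?thesis using e by (intro exI[of _ e] exI[of _ 0]) simp
  next
    assume K: "K = (n + 1) div 2"
    have "odd e" using n(2) e by simp
    then obtain t where t: "e = 2 * t + 1" by (rule oddE)
    obtain h where h: "d = 2 * h + 1" using odd_d by (rule oddE)
    \<comment> \<open>With \<open>n = d * (2 * t + 1)\<close> and \<open>d = 2 * h + 1\<close>, half
      of \<open>n + 1\<close> is \<open>t\<close> full blocks and a remainder \<open>Suc h\<close>,
      just above \<open>d / 2\<close>.\<close>
    have "n + 1 = 2 * (t * d + Suc h)" by (simp add: e t h algebra_simps)
    then have "K = t * d + Suc h" using K by simp
    then show ?thesis using h by (intro exI[of _ t] exI[of _ "Suc h"]) simp
  qed
  then obtain L r where Lr: "K = L * d + r" "r = 0 \<or> (d < 2 * r \<and> r \<le> d)" by blast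
  note per = periodic_ratio_powers[OF n]
  have "(\<Sum>k<K. wp_term q 1 1 k) \<in> I 1"
    unfolding Lr(1) by (intro wp_sum_mem Lr(2)) (simp_all add: per)
  moreover have "q ^ n * (\<Sum>k<K. wp_term q (q ^ n) (q ^ n) k) \<in> I 1"
    unfolding Lr(1) by (intro mult_mem_0 power_mem q_mem wp_sum_mem Lr(2) per)
  ultimately show ?thesis by (rule add_mem)
qed

end

section \<open>Primes of \<open>\<rat>[q]\<close>\<close>

text \<open>For prime \<pi> these are the powers of the maximal ideal of the localization of
  \<rat>[q] at \<pi>. Arbitrary representatives make the closure properties direct;
  \<open>numerator_in_prime_filtration\<close> passes to lowest terms.\<close>

definition prime_filtration :: "rat poly \<Rightarrow> nat \<Rightarrow> rat poly fract set" where
  "prime_filtration \<pi> m = {to_fract a / to_fract b | a b. \<pi> ^ m dvd a \<and> \<not> \<pi> dvd b}"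

lemma prime_filtrationI: "x = to_fract a / to_fract b \<Longrightarrow> \<pi> ^ m dvd a \<Longrightarrow> \<not> \<pi> dvd b \<Longrightarrow> x \<in> prime_filtration \<pi> m"
  by (auto simp: prime_filtration_def)

lemma prime_power_dvd_cancel:
  fixes \<pi> :: "rat poly"
  assumes "prime_elem \<pi>" "\<pi> ^ m dvd a * b" "\<not> \<pi> dvd b"
  shows "\<pi> ^ m dvd a"
proof -
  have "coprime \<pi> b" using assms(1,3) by (rule prime_elem_imp_coprime)
  then show ?thesis
    using assms(2) by (simp add: coprime_dvd_mult_left_iff)
qed

lemma to_fract_in_prime_filtration_iff:
  assumes "prime_elem \<pi>"
  shows "to_fract c \<in> prime_filtration \<pi> m \<longleftrightarrow> \<pi> ^ m dvd c"
proof
  assume "to_fract c \<in> prime_filtration \<pi> m"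
  then obtain a b where ab: "to_fract c = to_fract a / to_fract b" "\<pi> ^ m dvd a" "\<not> \<pi> dvd b"
    by (auto simp: prime_filtration_def)
  moreover have "to_fract b \<noteq> 0" using ab(3) by auto
  ultimately have "to_fract (c * b) = to_fract a"
    by (simp add: to_fract_mult del: to_fract_eq_iff)
  then have "c * b = a" by (simp only: to_fract_eq_iff)
  then have "\<pi> ^ m dvd c * b" using ab by simp
  then show "\<pi> ^ m dvd c" using prime_power_dvd_cancel assms ab by blast
next
  assume "\<pi> ^ m dvd c"
  moreover have "\<not> \<pi> dvd 1" using assms by (simp add: prime_elem_def)
  ultimately show "to_fract c \<in> prime_filtration \<pi> m"
    by (intro prime_filtrationI[of _ c 1]) auto
qed

lemma numerator_in_prime_filtration:
  assumes "prime_elem \<pi>" "x \<in> prime_filtration \<pi> m"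
  shows "\<pi> ^ m dvd fst (quot_of_fract x)"
proof -
  let ?n = "fst (quot_of_fract x)" and ?d = "snd (quot_of_fract x)"
  obtain a b where ab: "x = to_fract a / to_fract b" "\<pi> ^ m dvd a" "\<not> \<pi> dvd b"
    using assms(2) by (auto simp: prime_filtration_def)
  have "x = to_fract ?n / to_fract ?d" "?d \<noteq> 0"
    by (simp_all add: to_fract_quot_of_fract Fract_conv_to_fract[symmetric] snd_quot_of_fract_nonzero)
  moreover have "to_fract b \<noteq> 0" using ab(3) by auto
  ultimately have "to_fract ?n * to_fract b = to_fract a * to_fract ?d"
    using ab(1) by (metis (no_types) frac_eq_eq to_fract_eq_0_iff)
  then have "?n * b = a * ?d" by (simp only: to_fract_mult[symmetric] to_fract_eq_iff)
  then have "\<pi> ^ m dvd ?n * b" using ab(2) by simp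
  then show ?thesis using prime_power_dvd_cancel assms(1) ab(3) by blast
qed

lemma of_nat_poly_unit: "v > 0 \<Longrightarrow> (of_nat v :: rat poly) dvd 1"
  by (simp add: of_nat_poly is_unit_triv)

lemma local_filtration_prime:
  assumes p: "prime_elem \<pi>"
  shows "local_filtration (prime_filtration \<pi>)"
proof
  have nu: "\<not> \<pi> dvd c" if "c dvd 1" for c
    by (meson p that dvd_trans prime_elem_not_unit)
  have ndm: "\<not> \<pi> dvd b * b'" if "\<not> \<pi> dvd b" "\<not> \<pi> dvd b'" for b b'
    using p that by (simp add: prime_elem_dvd_mult_iff)
  have nz: "to_fract b \<noteq> 0" if "\<not> \<pi> dvd b" for b using that by auto
  show "0 \<in> prime_filtration \<pi> i" for i
    by (rule prime_filtrationI[of _ 0 1]) (use p in auto)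
  show "1 \<in> prime_filtration \<pi> 0"
    by (rule prime_filtrationI[of _ 1 1]) (use p in auto)
  show "of_nat v \<notin> prime_filtration \<pi> 1" if "v > 0" for v
  proof -
    have "(of_nat v :: rat poly fract) = to_fract (of_nat v)" by (induction v) simp_all
    then show ?thesis
      using to_fract_in_prime_filtration_iff[OF p, of "of_nat v" 1] nu[OF of_nat_poly_unit[OF that]] by simp
  qed
  from this[of 1] show "1 \<notin> prime_filtration \<pi> 1" by simp
  fix x y :: "rat poly fract" and i j :: nat
  show "- x \<in> prime_filtration \<pi> i" if x: "x \<in> prime_filtration \<pi> i"
  proof -
    obtain a b where "x = to_fract a / to_fract b" "\<pi> ^ i dvd a" "\<not> \<pi> dvd b"
      using x by (auto simp: prime_filtration_def)
    then show ?thesis by (intro prime_filtrationI[of _ "- a" b]) auto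
  qed
  show "x + y \<in> prime_filtration \<pi> i" if x: "x \<in> prime_filtration \<pi> i" "y \<in> prime_filtration \<pi> i"
  proof -
    obtain a b a' b' where "x = to_fract a / to_fract b" "\<pi> ^ i dvd a" "\<not> \<pi> dvd b"
      "y = to_fract a' / to_fract b'" "\<pi> ^ i dvd a'" "\<not> \<pi> dvd b'"
      using x by (auto simp: prime_filtration_def)
    then show ?thesis
      using nz[of b] nz[of b'] by (intro prime_filtrationI[of _ "a * b' + a' * b" "b * b'"]) (auto simp: add_frac_eq ndm)
  qed
  show "x * y \<in> prime_filtration \<pi> (i + j)" if x: "x \<in> prime_filtration \<pi> i" "y \<in> prime_filtration \<pi> j"
  proof -
    obtain a b a' b' where "x = to_fract a / to_fract b" "\<pi> ^ i dvd a" "\<not> \<pi> dvd b"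
      "y = to_fract a' / to_fract b'" "\<pi> ^ j dvd a'" "\<not> \<pi> dvd b'"
      using x by (auto simp: prime_filtration_def)
    then show ?thesis
      by (intro prime_filtrationI[of _ "a * a'" "b * b'"]) (auto simp: ndm power_add mult_dvd_mono)
  qed
  show "prime_filtration \<pi> (Suc i) \<subseteq> prime_filtration \<pi> i"
    using dvd_mult_right by (fastforce simp: prime_filtration_def)
  show "inverse x \<in> prime_filtration \<pi> 0" if x: "x \<in> prime_filtration \<pi> 0" "x \<notin> prime_filtration \<pi> 1"
  proof -
    obtain a b where ab: "x = to_fract a / to_fract b" "\<not> \<pi> dvd b"
      using x(1) by (auto simp: prime_filtration_def)
    then have "\<not> \<pi> dvd a" using x(2) prime_filtrationI[OF ab(1), of \<pi> 1] by auto
    then show ?thesis by (intro prime_filtrationI[of _ b a]) (auto simp: ab(1))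
  qed
qed

section \<open>The order of q modulo a prime factor of [n]\<close>

lemma qvar_power: "qvar ^ i = to_fract ([:0, 1:] ^ i)"
  by (simp add: qvar_def to_fract_power)

lemma one_minus_qvar_power: "1 - qvar ^ i = to_fract (1 - [:0, 1:] ^ i)"
  by (simp add: qvar_power)

lemma generic_base_qvar: "generic_base qvar"
proof
  show "qvar \<noteq> 0" by (simp add: qvar_def)
  fix i :: nat assume "i > 0"
  have "poly ([:0, 1:] ^ i) 0 \<noteq> poly (1 :: rat poly) 0" using \<open>i > 0\<close> by (simp add: poly_power power_0_left)
  then have "[:0, 1:] ^ i \<noteq> (1 :: rat poly)" by metis
  then show "qvar ^ i \<noteq> 1"
    by (metis qvar_power to_fract_1 to_fract_eq_iff)
qed

lemma qint_altdef: "qint n = (\<Sum>i<n. [:0, 1:] ^ i)"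
proof -
  have "(1 - [:0, 1:] :: rat poly) \<noteq> 0" by (simp add: one_pCons)
  then show ?thesis
    unfolding qint_def one_diff_power_eq by simp
qed

text \<open>If q were congruent to 1 modulo \<pi>, then [n] would be congruent to the integer n, a
  unit of \<rat>[q]. Hence q has order greater than 1 modulo every prime factor of [n].\<close>

lemma prime_dvd_qint:
  assumes p: "prime_elem \<pi>" and n: "n > 0" and d: "\<pi> dvd qint n"
  shows "\<not> \<pi> dvd 1 - [:0, 1:]" "\<pi> dvd 1 - [:0, 1:] ^ n"
proof -
  show "\<pi> dvd 1 - [:0, 1:] ^ n"
    unfolding one_diff_power_eq qint_altdef[symmetric] using d by simp
  show "\<not> \<pi> dvd 1 - [:0, 1:]"
  proof
    assume "\<pi> dvd 1 - [:0, 1:]"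
    then have "\<pi> dvd 1 - [:0, 1:] ^ i" for i
      unfolding one_diff_power_eq by (rule dvd_mult2)
    then have "\<pi> dvd (\<Sum>i<n. 1 - [:0, 1:] ^ i) + qint n"
      using d by (intro dvd_add dvd_sum) auto
    then have "\<pi> dvd of_nat n"
      by (simp add: qint_altdef sum_subtractf)
    then show False
      using p of_nat_poly_unit[OF n] dvd_trans by (auto simp: prime_elem_def)
  qed
qed

text \<open>The prime cannot divide a power of the variable, so powers can be cancelled. Division
  with remainder by the least positive exponent then gives the criterion.\<close>

lemma ex_order_modulo_prime:
  fixes \<pi> :: "rat poly"
  assumes p: "prime_elem \<pi>" and n: "n > 0" "\<pi> dvd 1 - [:0, 1:] ^ n"
  shows "\<exists>d>0. \<forall>i. \<pi> dvd 1 - [:0, 1:] ^ i \<longleftrightarrow> d dvd i"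
proof -
  let ?X = "[:0, 1:] :: rat poly"
  have nX: "\<not> \<pi> dvd ?X ^ i" for i
  proof
    assume "\<pi> dvd ?X ^ i"
    then have "\<pi> dvd ?X" using p prime_elem_dvd_power by blast
    then have "\<pi> dvd (1 - ?X ^ n) + ?X ^ n" using n by (intro dvd_add) (auto intro: dvd_trans[OF _ dvd_power])
    then show False using p by (simp add: prime_elem_def)
  qed
  define d where "d = (LEAST d. d > 0 \<and> \<pi> dvd 1 - ?X ^ d)"
  have d: "d > 0" "\<pi> dvd 1 - ?X ^ d"
    using LeastI[of "\<lambda>d. d > 0 \<and> \<pi> dvd 1 - ?X ^ d" n] n unfolding d_def by auto
  have d_le: "d \<le> r" if "r > 0" "\<pi> dvd 1 - ?X ^ r" for r
    unfolding d_def using that by (intro Least_le) simp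
  have "\<pi> dvd 1 - ?X ^ i \<longleftrightarrow> d dvd i" for i
  proof -
    have dt: "\<pi> dvd 1 - ?X ^ (d * t)" for t
      unfolding power_mult one_diff_power_eq[of "?X ^ d" t] using d(2) by simp
    have "1 - ?X ^ i = (1 - ?X ^ (d * (i div d))) + ?X ^ (d * (i div d)) * (1 - ?X ^ (i mod d))"
      by (simp add: algebra_simps flip: power_add)
    then have "\<pi> dvd 1 - ?X ^ i \<longleftrightarrow> \<pi> dvd ?X ^ (d * (i div d)) * (1 - ?X ^ (i mod d))"
      using dvd_add_right_iff[OF dt] by metis
    also have "\<dots> \<longleftrightarrow> \<pi> dvd 1 - ?X ^ (i mod d)"
      using nX p prime_elem_dvd_mult_iff by blast
    also have "\<dots> \<longleftrightarrow> i mod d = 0"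
    proof
      assume *: "\<pi> dvd 1 - ?X ^ (i mod d)"
      show "i mod d = 0"
      proof (rule ccontr)
        assume "i mod d \<noteq> 0"
        then have "d \<le> i mod d" using * by (intro d_le) simp
        then show False using d(1) mod_less_divisor[of d i] by linarith
      qed
    qed simp
    finally show ?thesis by (simp add: dvd_eq_mod_eq_0)
  qed
  then show ?thesis using d(1) by blast
qed

lemma filtered_base_prime:
  assumes p: "prime_elem \<pi>" and d: "\<And>i. \<pi> dvd 1 - [:0, 1:] ^ i \<longleftrightarrow> d dvd i" "odd d" "d > 1"
  shows "filtered_base qvar (prime_filtration \<pi>) d"
proof -
  interpret local_filtration "prime_filtration \<pi>" by (rule local_filtration_prime[OF p])
  interpret generic_base qvar by (rule generic_base_qvar)
  note iff = to_fract_in_prime_filtration_iff[OF p]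
  have near: "1 - qvar ^ i \<in> prime_filtration \<pi> 1 \<longleftrightarrow> d dvd i" for i
    unfolding one_minus_qvar_power using iff[of "1 - [:0, 1:] ^ i" 1] d(1)[of i] by simp
  have "local_unit (qvar ^ d)" by (rule near_1_unit) (simp only: near dvd_refl)
  moreover have q0: "qvar \<in> prime_filtration \<pi> 0" unfolding qvar_def iff by simp
  \<comment> \<open>If \<open>qvar\<close> lay in the maximal ideal, so would its power
    \<open>qvar ^ d\<close>, which is congruent to 1.\<close>
  moreover have "qvar ^ d \<in> prime_filtration \<pi> 1" if "qvar \<in> prime_filtration \<pi> 1"
  proof -
    have "qvar ^ d = qvar * qvar ^ (d - 1)" using d(3) by (cases d) simp_all
    then show ?thesis using mult_mem_0'[OF that power_mem[OF q0]] by simp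
  qed
  ultimately have "qvar \<notin> prime_filtration \<pi> 1"
    unfolding local_unit_def by blast
  then have "root_order qvar d"
    unfolding root_order_def local_unit_def using near q0 by blast
  then show ?thesis by unfold_locales (use d in auto)
qed

section \<open>Cyclotomic factors, squarefreeness and the divisibility criterion for the
  modulus\<close>

lemma prod_cyclotomic:
  assumes "n > 0"
  shows "(\<Prod>d | d dvd n. cyclotomic d) = monom 1 n - 1"
proof -
  have "map_poly of_rat (\<Prod>d | d dvd n. cyclotomic d) = (\<Prod>d | d dvd n. cyclotomic_complex d)"
    unfolding map_poly_of_rat_prod
    by (intro prod.cong) (use assms in \<open>auto intro!: map_poly_of_rat_cyclotomic intro: dvd_pos_nat\<close>)
  also have "\<dots> = map_poly of_rat (monom 1 n - 1)"
    unfolding prod_cyclotomic_complex[OF assms]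
    by (rule poly_eqI) (simp add: coeff_map_poly of_rat_diff)
  finally show ?thesis by (simp only: map_poly_of_rat_eq_iff)
qed

text \<open>A repeated prime factor would divide the derivative, hence \<open>monom 1 n\<close>, and
  also \<open>monom 1 n - 1\<close>, hence 1.\<close>

lemma monom_minus_1_squarefree:
  fixes \<pi> :: "rat poly"
  assumes p: "prime_elem \<pi>" and n: "n > 0"
  shows "\<not> \<pi> ^ 2 dvd monom 1 n - 1"
proof
  assume "\<pi> ^ 2 dvd monom 1 n - 1"
  then obtain c where "monom 1 n - 1 = \<pi> ^ 2 * c" by (rule dvdE)
  then have c: "monom 1 n - 1 = \<pi> * (\<pi> * c)" by (simp only: power2_eq_square mult.assoc)
  have "pderiv (monom 1 n - 1 :: rat poly) = monom (of_nat n) (n - 1)"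
    by (simp add: pderiv_diff pderiv_monom)
  moreover have "\<pi> dvd pderiv (monom 1 n - 1)" unfolding c by (simp add: pderiv_mult)
  ultimately have "\<pi> dvd monom (of_nat n) (n - 1)" by simp
  then have "\<pi> dvd monom (of_nat n) (n - 1) * monom (1 / of_nat n) 1" by (rule dvd_mult2)
  then have "\<pi> dvd monom 1 n" using n by (simp add: mult_monom)
  moreover have "\<pi> dvd monom 1 n - 1" unfolding c by simp
  ultimately have "\<pi> dvd monom 1 n - (monom 1 n - 1)" by (rule dvd_diff)
  then show False using p by (simp add: prime_elem_def)
qed

lemma X_power_eq: "1 - [:0, 1:] ^ n = - (monom 1 n - 1 :: rat poly)"
  by (simp add: monom_altdef)

lemma cyclotomic_dvd: "n > 0 \<Longrightarrow> d dvd n \<Longrightarrow> cyclotomic d dvd monom 1 n - 1"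
  using prod_cyclotomic[of n] dvd_prodI[of "{d. d dvd n}" d cyclotomic] by simp

text \<open>If the order were a proper divisor of \<open>n\<close>, then \<pi> would also divide
  \<open>cyclotomic e\<close> for some \<open>e \<noteq> n\<close> dividing \<open>n\<close>, making
  \<pi> a double factor of \<open>monom 1 n - 1\<close>.\<close>

lemma prime_dvd_cyclotomic_order:
  assumes p: "prime \<pi>" and n: "n > 0" and c: "\<pi> dvd cyclotomic n"
    and d: "\<And>i. \<pi> dvd 1 - [:0, 1:] ^ i \<longleftrightarrow> d dvd i"
  shows "d = n"
proof (rule ccontr)
  assume "d \<noteq> n"
  have "\<pi> dvd monom 1 n - 1" using c cyclotomic_dvd[OF n dvd_refl] dvd_trans by blast
  then have dn: "d dvd n" using d[of n] unfolding X_power_eq dvd_minus_iff by blast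
  have "\<pi> dvd monom 1 d - 1" using d[of d] dvd_refl[of d] unfolding X_power_eq dvd_minus_iff by blast
  then have "\<pi> dvd (\<Prod>e | e dvd d. cyclotomic e)"
    using prod_cyclotomic[of d] dn n by (simp add: dvd_pos_nat)
  then obtain e where e: "e dvd d" "\<pi> dvd cyclotomic e"
    using prime_dvd_prod_iff[OF _ p, of "{e. e dvd d}"] dn n by (auto simp: dvd_pos_nat)
  have "e \<noteq> n" using e(1) \<open>d \<noteq> n\<close> dn by (meson dvd_antisym)
  then have "(\<Prod>d\<in>{n, e}. cyclotomic d) dvd (\<Prod>d | d dvd n. cyclotomic d)"
    using n e(1) dn by (intro prod_dvd_prod_subset) (auto intro: dvd_trans)
  then have "cyclotomic n * cyclotomic e dvd monom 1 n - 1"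
    using \<open>e \<noteq> n\<close> by (simp add: prod_cyclotomic[OF n])
  moreover have "\<pi> ^ 2 dvd cyclotomic n * cyclotomic e"
    unfolding power2_eq_square by (intro mult_dvd_mono c e)
  ultimately show False
    using monom_minus_1_squarefree[OF prime_imp_prime_elem[OF p] n] dvd_trans by blast
qed

lemma multiplicity_le_1:
  fixes \<pi> :: "rat poly"
  assumes "prime_elem \<pi>" "n > 0" "a dvd monom 1 n - 1"
  shows "multiplicity \<pi> a \<le> 1"
proof (rule ccontr)
  assume "\<not> ?thesis"
  then have "\<pi> ^ 2 dvd a" by (intro multiplicity_dvd') simp
  then show False using monom_minus_1_squarefree assms dvd_trans by blast
qed

text \<open>Both factors of the modulus divide the squarefree \<open>monom 1 n - 1\<close>. A prime
  therefore has multiplicity at most 4 in the modulus, and at most 1 if it does not divide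
  \<open>cyclotomic n\<close>.\<close>

lemma qint_cyclotomic_dvdI:
  assumes n: "n > 0" and N: "\<And>\<pi>. prime \<pi> \<Longrightarrow> \<pi> dvd qint n \<Longrightarrow> \<pi> dvd N"
    "\<And>\<pi>. prime \<pi> \<Longrightarrow> \<pi> dvd cyclotomic n \<Longrightarrow> \<pi> ^ 4 dvd N"
  shows "qint n * cyclotomic n ^ 3 dvd N"
proof (cases "N = 0")
  case False
  have m0: "(monom 1 n - 1 :: rat poly) \<noteq> 0"
  proof
    assume "(monom 1 n - 1 :: rat poly) = 0"
    then have "coeff (monom 1 n - 1 :: rat poly) n = 0" by simp
    then show False using n by simp
  qed
  have q: "qint n dvd monom 1 n - 1"
  proof -
    have "qint n dvd 1 - [:0, 1:] ^ n" unfolding one_diff_power_eq qint_altdef by simp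
    then show ?thesis unfolding X_power_eq dvd_minus_iff .
  qed
  have c: "cyclotomic n dvd monom 1 n - 1" by (rule cyclotomic_dvd[OF n dvd_refl])
  have nz: "qint n \<noteq> 0" "cyclotomic n \<noteq> 0" using q c m0 by auto
  show ?thesis
  proof (rule multiplicity_le_imp_dvd)
    fix \<pi> :: "rat poly" assume p: "prime \<pi>"
    then have pe: "prime_elem \<pi>" by simp
    have mult: "multiplicity \<pi> (qint n * cyclotomic n ^ 3) = multiplicity \<pi> (qint n) + 3 * multiplicity \<pi> (cyclotomic n)"
      using nz by (simp add: prime_elem_multiplicity_mult_distrib[OF pe] prime_elem_multiplicity_power_distrib[OF pe])
    note le = multiplicity_le_1[OF pe n q] multiplicity_le_1[OF pe n c]
    show "multiplicity \<pi> (qint n * cyclotomic n ^ 3) \<le> multiplicity \<pi> N"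
    proof (cases "\<pi> dvd cyclotomic n")
      case True
      then have "4 \<le> multiplicity \<pi> N"
        using N(2)[OF p] False pe by (intro multiplicity_geI) (auto simp: prime_elem_def)
      then show ?thesis using le unfolding mult by linarith
    next
      case False
      then have "multiplicity \<pi> (cyclotomic n) = 0" by (rule not_dvd_imp_multiplicity_0)
      moreover have "multiplicity \<pi> (qint n) \<le> multiplicity \<pi> N"
      proof (cases "\<pi> dvd qint n")
        case True
        then have "1 \<le> multiplicity \<pi> N"
          using N(1)[OF p] \<open>N \<noteq> 0\<close> pe by (intro multiplicity_geI) (auto simp: prime_elem_def)
        then show ?thesis using le by linarith
      qed (simp add: not_dvd_imp_multiplicity_0)
      ultimately show ?thesis unfolding mult by simp
    qed
  qed (use nz in simp)
qed simp

theorem mainTheorem2: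
  fixes n M :: nat
  assumes "n > 0" and "n mod 4 = 3"
    and "M = (n - 1) div 2 \<or> M = n - 1"
  shows "fract_cong
    (\<Sum>k = 0..M. (- 1) ^ k * to_fract (qint (4 * k + 1))
        * (qpoch qvar (qvar ^ 2) k ^ 4 * qpoch (qvar ^ 2) (qvar ^ 4) k)
        / (qpoch (qvar ^ 2) (qvar ^ 2) k ^ 4 * qpoch (qvar ^ 4) (qvar ^ 4) k)
        * qvar ^ k)
    (to_fract (qint n) ^ 2 * qvar ^ ((1 + n) div 2)
        * (qpoch (qvar ^ 3) (qvar ^ 4) ((n - 1) div 2) / qpoch (qvar ^ 5) (qvar ^ 4) ((n - 1) div 2)))
    (qint n * cyclotomic n ^ 3)"
proof -
  interpret generic_base qvar by (rule generic_base_qvar)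
  have odd: "odd n" and n1: "n > 1" using assms(2) by presburger+
  \<comment> \<open>For both choices of \<open>M\<close>, \<open>K\<close> is large enough for the
    sums at \<open>q ^ n\<close> to have terminated, yet every index stays below
    \<open>n\<close>.\<close>
  define K where "K = Suc M"
  have K: "n < 2 * K" "K \<le> n" "K = n \<or> K = (n + 1) div 2"
    using assms odd by (auto simp: K_def elim!: oddE)
  have pr: "poch_ratio p 1 k = qpoch p (p ^ 2) k / qpoch (p ^ 2) (p ^ 2) k" for p :: "rat poly fract" and k
    unfolding poch_ratio_def qpoch_def prod_dividef[symmetric]
    by (simp add: power_add power_mult power2_eq_square power_mult_distrib mult_ac)
  have summand: "(- 1) ^ k * to_fract (qint (4 * k + 1))
        * (qpoch qvar (qvar ^ 2) k ^ 4 * qpoch (qvar ^ 2) (qvar ^ 4) k)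
        / (qpoch (qvar ^ 2) (qvar ^ 2) k ^ 4 * qpoch (qvar ^ 4) (qvar ^ 4) k)
        * qvar ^ k = wp_term qvar 1 1 k" for k
  proof -
    have "(- qvar) ^ k = (- 1) ^ k * qvar ^ k" by (rule power_minus)
    moreover have "(qvar ^ 2) ^ 2 = qvar ^ 4" by simp
    ultimately show ?thesis
      by (simp add: wp_term_def pr to_fract_qint eval_nat_numeral mult_ac)
  qed
  \<comment> \<open>By \<open>wp_diagonal_sum_qpoch\<close> the right-hand side is
    \<open>- (qvar ^ n)\<close> times the diagonal sum, so \<open>x\<close> is the difference of the
    two sides.\<close>
  define x where "x = (\<Sum>k<K. wp_term qvar 1 1 k) + qvar ^ n * (\<Sum>k<K. wp_term qvar (qvar ^ n) (qvar ^ n) k)"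
  have diff: "(\<Sum>k = 0..M. (- 1) ^ k * to_fract (qint (4 * k + 1))
        * (qpoch qvar (qvar ^ 2) k ^ 4 * qpoch (qvar ^ 2) (qvar ^ 4) k)
        / (qpoch (qvar ^ 2) (qvar ^ 2) k ^ 4 * qpoch (qvar ^ 4) (qvar ^ 4) k)
        * qvar ^ k)
    - (to_fract (qint n) ^ 2 * qvar ^ ((1 + n) div 2)
        * (qpoch (qvar ^ 3) (qvar ^ 4) ((n - 1) div 2) / qpoch (qvar ^ 5) (qvar ^ 4) ((n - 1) div 2))) = x"
    unfolding summand unfolding to_fract_qint wp_diagonal_sum_qpoch[OF assms(2) K(1)] x_def
    by (simp add: K_def atLeast0AtMost lessThan_Suc_atMost)
  have "qint n * cyclotomic n ^ 3 dvd fst (quot_of_fract x)"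
  proof (rule qint_cyclotomic_dvdI[OF assms(1)])
    fix \<pi> :: "rat poly" assume "prime \<pi>" and dvd: "\<pi> dvd qint n"
    then have pe: "prime_elem \<pi>" by simp
    note X = prime_dvd_qint[OF pe assms(1) dvd]
    obtain d where d: "d > 0" "\<And>i. \<pi> dvd 1 - [:0, 1:] ^ i \<longleftrightarrow> d dvd i"
      using ex_order_modulo_prime[OF pe assms(1) X(2)] by blast
    have dn: "d dvd n" using d(2) X(2) by blast
    have "d \<noteq> 1" using X(1) d(2)[of 1] by auto
    then have "d > 1" using d(1) by simp
    moreover have "odd d" using dn odd dvd_trans by blast
    ultimately interpret filtered_base qvar "prime_filtration \<pi>" d
      using filtered_base_prime[OF pe d(2)] by blast
    have "x \<in> prime_filtration \<pi> 1"
      unfolding x_def by (rule wp_sum_mod_1[OF dn odd K(3)])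
    from numerator_in_prime_filtration[OF pe this] show "\<pi> dvd fst (quot_of_fract x)" by simp
  next
    fix \<pi> :: "rat poly" assume pr: "prime \<pi>" and dvd: "\<pi> dvd cyclotomic n"
    then have pe: "prime_elem \<pi>" by simp
    have "\<pi> dvd monom 1 n - 1"
      using dvd cyclotomic_dvd[OF assms(1) dvd_refl] dvd_trans by blast
    then have "\<pi> dvd 1 - [:0, 1:] ^ n" unfolding X_power_eq dvd_minus_iff .
    then obtain d where "\<And>i. \<pi> dvd 1 - [:0, 1:] ^ i \<longleftrightarrow> d dvd i"
      using ex_order_modulo_prime[OF pe assms(1)] by blast
    \<comment> \<open>At a prime factor of \<open>cyclotomic n\<close> the order is \<open>n\<close>
      itself, so the fourth-order congruence is available with \<open>d = n\<close>.\<close>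
    moreover from prime_dvd_cyclotomic_order[OF pr assms(1) dvd this] have "d = n" .
    ultimately interpret filtered_base qvar "prime_filtration \<pi>" n
      using filtered_base_prime[OF pe _ odd n1] by blast
    have "x \<in> prime_filtration \<pi> 4"
      unfolding x_def by (rule wp_sum_mod_4[OF assms(2) K(1,2)])
    from numerator_in_prime_filtration[OF pe this] show "\<pi> ^ 4 dvd fst (quot_of_fract x)" .
  qed
  then show ?thesis unfolding fract_cong_def diff .
qed

end
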